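(* Let $\mathcal{A}$ be a $U(\mathfrak{g})$ invariant commutative algebra with multiplication $\mu$, and let $\mathcal{A}_h$ be a $U_h(\mathfrak{g})$ invariant quantization of $\mathcal{A}$, with multiplication $\mu_h=\mu+h\mu_1+o(h)$ and corresponding Poisson bracket $\{a,b\}=\mu_1(a,b)-\mu_1(b,a)$, $a,b\in\mathcal{A}$. Then $$\{a,b\}=f(a,b)-\{a,b\}_r ,\qquad a,b\in\mathcal{A},$$ where $f$ is a $U(\mathfrak{g})$ invariant bracket on $\mathcal{A}$ and $\{\cdot,\cdot\}_r$ is the $r$-matrix bracket. Moreover, the brackets $f$ and $\{\cdot,\cdot\}_r$ are compatible, i.e. $[\![f,\{\cdot,\cdot\}_r]\!]=0$, and $[\![f,f]\!]=-\varphi_{\mathcal{A}}$.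
   Context: Let $\mathfrak{g}$ be a simple complex Lie algebra with Cartan subalgebra $\mathfrak h$, positive roots $\Omega^+$, and root vectors $E_{\alpha},E_{-\alpha}$ ($\alpha\in\Omega^+$) normalized by $(E_\alpha,E_{-\alpha})=1$ for the Killing form. Let $r=\sum_{\alpha\in\Omega^+}E_\alpha\wedge E_{-\alpha}\in\wedge^2\mathfrak g$ be the Drinfeld-Jimbo $r$-matrix, viewed as a skew-symmetric tensor $r=r_1\otimes r_2$ (summation implicit), and let $\varphi=[\![r,r]\!]\in\wedge^3\mathfrak g$ be its Schouten square, which is a $\mathfrak g$-invariant element. All tensor products over $\mathbb{C}[[h]]$ are completed in the $h$-adic topology. By a theorem of Drinfeld there are a $\mathfrak g$-invariant element $\Phi_h=1\otimes1\otimes1+h^2\varphi+\cdots\in U(\mathfrak g)[[h]]^{\otimes 3}$ satisfying, with the usual comultiplication $\Delta$ of $U(\mathfrak g)$, $(id\otimes\Delta)(\Delta(b))\Phi_h=\Phi_h(\Delta\otimes id)(\Delta(b))$ and the pentagon identity $(id^{\otimes2}\otimes\Delta)(\Phi_h)(\Delta\otimes id^{\otimes2})(\Phi_h)=(1\otimes\Phi_h)(id\otimes\Delta\otimes id)(\Phi_h)(\Phi_h\otimes1)$, and an element $F_h=1\otimes1+(h/2)r+\cdots\in U(\mathfrak g)[[h]]^{\otimes2}$ such that $(1\otimes F_h)(id\otimes\Delta)(F_h)\,\Phi_h\,(\Delta\otimes id)(F_h^{-1})(F_h\otimes1)^{-1}=1\otimes1\otimes1$. The quantum group $U_h(\mathfrak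 g)$ is the bialgebra $U(\mathfrak g)[[h]]$ with undeformed multiplication and comultiplication $\Delta_h(x)=F_h\Delta(x)F_h^{-1}$. A $U(\mathfrak g)$ invariant commutative algebra is a commutative algebra $\mathcal A$ with a $U(\mathfrak g)$-module structure whose multiplication $\mu$ satisfies $b\,\mu(x\otimes y)=\mu\,\Delta(b)(x\otimes y)$ for $b\in U(\mathfrak g)$. A quantization of $\mathcal A$ is an associative algebra $\mathcal A_h$ isomorphic to $\mathcal A[[h]]$ as a $\mathbb C[[h]]$-module, with multiplication $\mu_h=\mu+h\mu_1+o(h)$; it is $U_h(\mathfrak g)$ invariant if $x\,\mu_h(a\otimes b)=\mu_h\,\Delta_h(x)(a\otimes b)$ for all $x\in U_h(\mathfrak g)$ and $a,b\in\mathcal A$. A bracket on $\mathcal A$ is a skew-symmetric bilinear map $\mathcal A\otimes\mathcal A\to\mathcal A$ satisfying the Leibniz rule in each argument; it is a Poisson bracket if it also satisfies the Jacobi identity. The $r$-matrix bracket is $\{a,b\}_r=(r_1a)(r_2b)$. The Schouten bracket of two brackets $f,g$ on $\mathcal{A}$ is $[\![f,g]\!](a,b,c)=f(g(a,b),c)+g(f(a,b),c)+\text{cyclic permutations of }a,b,c$; $f$ and $g$ are compatible if $[\![f,g]\!]=0$. Finally $\varphi_{\mathcal A}(a,b,c)=(\varphi_1a)(\varphi_2b)(\varphi_3c)$ where $\varphi=\varphi_1\otimes\varphi_2\otimes\varphi_3$ (summation implicit); the identification of $\wedge^3\mathfrak g$ with skew-symmetric tensors is normalized consistently, so that the Schouten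 bracket of $\{\cdot,\cdot\}_r$ with itself equals $\varphi_{\mathcal A}$. *)

theory Defs
  imports "HOL-Computational_Algebra.Formal_Power_Series"
begin

unbundle fps_syntax

section \<open>Complex vector spaces, algebras and Lie algebras\<close>

class complex_vector = ab_group_add +
  fixes scaleC :: "complex \<Rightarrow> 'a \<Rightarrow> 'a" (infixr "*\<^sub>C" 75)
  assumes scaleC_add_right: "c *\<^sub>C (x + y) = c *\<^sub>C x + c *\<^sub>C y"
    and scaleC_add_left: "(c + d) *\<^sub>C x = c *\<^sub>C x + d *\<^sub>C x"
    and scaleC_scaleC: "c *\<^sub>C d *\<^sub>C x = (c * d) *\<^sub>C x"
    and scaleC_one: "1 *\<^sub>C x = x"

global_interpretation cvec: vector_space "scaleC :: complex \<Rightarrow> 'a \<Rightarrow> 'a::complex_vector"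
  by unfold_locales (simp_all add: scaleC_add_right scaleC_add_left scaleC_scaleC scaleC_one)

text \<open>No unit is required here; the algebras acted upon below need not be unital.\<close>

class complex_algebra = complex_vector + ring +
  assumes scaleC_mult_left: "(c *\<^sub>C x) * y = c *\<^sub>C (x * y)"
    and scaleC_mult_right: "x * (c *\<^sub>C y) = c *\<^sub>C (x * y)"

class complex_comm_algebra = complex_algebra + comm_ring

class complex_algebra_1 = complex_algebra + ring_1

class complex_lie_algebra = complex_vector +
  fixes lie :: "'a \<Rightarrow> 'a \<Rightarrow> 'a"
  assumes lie_add_left: "lie (x + y) z = lie x z + lie y z"
    and lie_add_right: "lie x (y + z) = lie x y + lie x z"
    and lie_scaleC_left: "lie (c *\<^sub>C x) y = c *\<^sub>C lie x y"
    and lie_scaleC_right: "lie x (c *\<^sub>C y) = c *\<^sub>C lie x y"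
    and lie_self: "lie x x = 0"
    and lie_jacobi: "lie x (lie y z) + lie y (lie z x) + lie z (lie x y) = 0"

instantiation complex :: complex_algebra_1
begin
definition scaleC_complex :: "complex \<Rightarrow> complex \<Rightarrow> complex"
  where "scaleC_complex c x = c * x"
instance
  by standard (simp_all add: scaleC_complex_def algebra_simps)
end

abbreviation clinear :: "('a::complex_vector \<Rightarrow> 'b::complex_vector) \<Rightarrow> bool"
  where "clinear \<equiv> Vector_Spaces.linear scaleC scaleC"

definition cbilinear :: "('a::complex_vector \<Rightarrow> 'b::complex_vector \<Rightarrow> 'c::complex_vector) \<Rightarrow> bool"
  where "cbilinear f \<longleftrightarrow> (\<forall>x. clinear (f x)) \<and> (\<forall>y. clinear (\<lambda>x. f x y))"

lemma clinear_iff: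
  "clinear f \<longleftrightarrow> (\<forall>x y. f (x + y) = f x + f y) \<and> (\<forall>c x. f (c *\<^sub>C x) = c *\<^sub>C f x)"
proof -
  have "vector_space (scaleC :: complex \<Rightarrow> 'a \<Rightarrow> 'a)"
    and "vector_space (scaleC :: complex \<Rightarrow> 'b \<Rightarrow> 'b)"
    by unfold_locales
  then show ?thesis
    by (auto simp: Vector_Spaces.linear_def module_hom_def module_hom_axioms_def
        vector_space_def module_def)
qed

lemma cbilinear_iff:
  "cbilinear f \<longleftrightarrow>
    (\<forall>x y z. f (x + y) z = f x z + f y z) \<and> (\<forall>x y z. f x (y + z) = f x y + f x z) \<and>
    (\<forall>c x y. f (c *\<^sub>C x) y = c *\<^sub>C f x y) \<and> (\<forall>c x y. f x (c *\<^sub>C y) = c *\<^sub>C f x y)"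
  by (auto simp: cbilinear_def clinear_iff)


section \<open>Tensor products of complex vector spaces\<close>

text \<open>
  The tensor product is presented by generators and relations: formal linear expressions
  in symbols \<open>TPure a b\<close>, modulo the least congruence containing the vector space axioms
  and the bilinearity relations.
\<close>

datatype (plugins del: size) ('a, 'b) texp =
    TPure 'a 'b
  | TZero
  | TAdd "('a, 'b) texp" "('a, 'b) texp"
  | TScale complex "('a, 'b) texp"

inductive teq :: "('a::complex_vector, 'b::complex_vector) texp \<Rightarrow> ('a, 'b) texp \<Rightarrow> bool" where
  refl: "teq s s"
| sym: "teq s t \<Longrightarrow> teq t s"
| trans: "teq s t \<Longrightarrow> teq t u \<Longrightarrow> teq s u"
| cong_add: "teq s s' \<Longrightarrow> teq t t' \<Longrightarrow> teq (TAdd s t) (TAdd s' t')"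
| cong_scale: "teq s s' \<Longrightarrow> teq (TScale c s) (TScale c s')"
| add_assoc: "teq (TAdd (TAdd s t) u) (TAdd s (TAdd t u))"
| add_commute: "teq (TAdd s t) (TAdd t s)"
| add_zero: "teq (TAdd TZero s) s"
| add_inverse: "teq (TAdd (TScale (-1) s) s) TZero"
| scale_add_right: "teq (TScale c (TAdd s t)) (TAdd (TScale c s) (TScale c t))"
| scale_add_left: "teq (TScale (c + d) s) (TAdd (TScale c s) (TScale d s))"
| scale_scale: "teq (TScale c (TScale d s)) (TScale (c * d) s)"
| scale_one: "teq (TScale 1 s) s"
| pure_add_left: "teq (TPure (a + a') b) (TAdd (TPure a b) (TPure a' b))"
| pure_add_right: "teq (TPure a (b + b')) (TAdd (TPure a b) (TPure a b'))"
| pure_scale_left: "teq (TPure (c *\<^sub>C a) b) (TScale c (TPure a b))"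
| pure_scale_right: "teq (TPure a (c *\<^sub>C b)) (TScale c (TPure a b))"

quotient_type (overloaded) ('a, 'b) tensor =
  "('a::complex_vector, 'b::complex_vector) texp" / teq
  by (rule equivpI) (auto intro: reflpI sympI transpI teq.refl teq.sym teq.trans)

lift_definition pure_tensor ::
    "'a::complex_vector \<Rightarrow> 'b::complex_vector \<Rightarrow> ('a, 'b) tensor" (infixr "\<otimes>\<^sub>t" 73)
  is TPure .

instantiation tensor :: (complex_vector, complex_vector) complex_vector
begin

lift_definition zero_tensor :: "('a, 'b) tensor" is TZero .
lift_definition plus_tensor :: "('a, 'b) tensor \<Rightarrow> ('a, 'b) tensor \<Rightarrow> ('a, 'b) tensor"
  is TAdd by (rule teq.cong_add)
lift_definition scaleC_tensor :: "complex \<Rightarrow> ('a, 'b) tensor \<Rightarrow> ('a, 'b) tensor"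
  is TScale by (rule teq.cong_scale)
lift_definition uminus_tensor :: "('a, 'b) tensor \<Rightarrow> ('a, 'b) tensor"
  is "TScale (-1)" by (rule teq.cong_scale)
lift_definition minus_tensor :: "('a, 'b) tensor \<Rightarrow> ('a, 'b) tensor \<Rightarrow> ('a, 'b) tensor"
  is "\<lambda>s t. TAdd s (TScale (-1) t)" by (intro teq.cong_add teq.cong_scale)

instance
  by (standard; transfer)
    (rule teq.add_assoc teq.add_commute teq.add_zero teq.add_inverse teq.refl
      teq.scale_add_right teq.scale_add_left teq.scale_scale teq.scale_one)+

end

lemma pure_tensor_add_left: "(a + a') \<otimes>\<^sub>t b = a \<otimes>\<^sub>t b + a' \<otimes>\<^sub>t b"
  by transfer (rule teq.pure_add_left)

lemma pure_tensor_add_right: "a \<otimes>\<^sub>t (b + b') = a \<otimes>\<^sub>t b + a \<otimes>\<^sub>t b'"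
  by transfer (rule teq.pure_add_right)

lemma pure_tensor_scaleC_left: "(c *\<^sub>C a) \<otimes>\<^sub>t b = c *\<^sub>C (a \<otimes>\<^sub>t b)"
  by transfer (rule teq.pure_scale_left)

lemma pure_tensor_scaleC_right: "a \<otimes>\<^sub>t (c *\<^sub>C b) = c *\<^sub>C (a \<otimes>\<^sub>t b)"
  by transfer (rule teq.pure_scale_right)

lemma tensor_induct [case_names pure zero add scale]:
  assumes "\<And>a b. P (a \<otimes>\<^sub>t b)" and "P 0" and "\<And>s t. P s \<Longrightarrow> P t \<Longrightarrow> P (s + t)"
    and "\<And>c s. P s \<Longrightarrow> P (c *\<^sub>C s)"
  shows "P t"
proof (induction t rule: tensor.abs_induct)
  case (1 e)
  show ?case
    using assms
    by (induction e)
      (simp_all flip: pure_tensor.abs_eq zero_tensor.abs_eq plus_tensor.abs_eq scaleC_tensor.abs_eq)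
qed

primrec teval :: "('a::complex_vector \<Rightarrow> 'b::complex_vector \<Rightarrow> 'c::complex_vector) \<Rightarrow>
    ('a, 'b) texp \<Rightarrow> 'c" where
  "teval f (TPure a b) = f a b"
| "teval f TZero = 0"
| "teval f (TAdd s t) = teval f s + teval f t"
| "teval f (TScale c s) = c *\<^sub>C teval f s"

lemma teval_respects: "teq s t \<Longrightarrow> cbilinear f \<Longrightarrow> teval f s = teval f t"
  by (induction rule: teq.induct)
    (simp_all add: cbilinear_iff scaleC_add_right scaleC_add_left scaleC_scaleC scaleC_one)

text \<open>The linear map induced by a bilinear map \<open>f\<close>; the value for other \<open>f\<close> is irrelevant.\<close>

lift_definition tensor_lift ::
    "('a::complex_vector \<Rightarrow> 'b::complex_vector \<Rightarrow> 'c::complex_vector) \<Rightarrow> ('a, 'b) tensor \<Rightarrow> 'c"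
  is "\<lambda>f. if cbilinear f then teval f else (\<lambda>_. 0)"
  using teval_respects by auto

lemma tensor_lift_pure [simp]: "cbilinear f \<Longrightarrow> tensor_lift f (a \<otimes>\<^sub>t b) = f a b"
  by transfer simp

lemma tensor_lift_zero [simp]: "tensor_lift f 0 = 0"
  by transfer simp

lemma tensor_lift_add: "tensor_lift f (s + t) = tensor_lift f s + tensor_lift f t"
  by transfer simp

lemma tensor_lift_scaleC: "tensor_lift f (c *\<^sub>C s) = c *\<^sub>C tensor_lift f s"
  by transfer simp

lemma clinear_tensor_lift: "clinear (tensor_lift f)"
  by (simp add: clinear_iff tensor_lift_add tensor_lift_scaleC)

definition tensor_map ::
    "('a::complex_vector \<Rightarrow> 'c::complex_vector) \<Rightarrow> ('b::complex_vector \<Rightarrow> 'd::complex_vector) \<Rightarrow>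
      ('a, 'b) tensor \<Rightarrow> ('c, 'd) tensor"
  where "tensor_map f g = tensor_lift (\<lambda>a b. f a \<otimes>\<^sub>t g b)"

definition tensor_assoc ::
    "(('a::complex_vector, 'b::complex_vector) tensor, 'c::complex_vector) tensor \<Rightarrow>
      ('a, ('b, 'c) tensor) tensor"
  where "tensor_assoc = tensor_lift (\<lambda>ab c. tensor_lift (\<lambda>a b. a \<otimes>\<^sub>t b \<otimes>\<^sub>t c) ab)"


subsection \<open>Tensor products of unital algebras\<close>

lemma ex_clinear_functional:
  fixes v :: "'a::complex_vector"
  assumes "v \<noteq> 0"
  shows "\<exists>f :: 'a \<Rightarrow> complex. clinear f \<and> f v = 1"
proof -
  interpret vector_space_pair "scaleC :: complex \<Rightarrow> 'a \<Rightarrow> 'a"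
      "scaleC :: complex \<Rightarrow> complex \<Rightarrow> complex"
    by unfold_locales
  have "cvec.independent {v}"
    using assms by simp
  from linear_independent_extend[OF this, of "\<lambda>_. 1"] show ?thesis
    by auto
qed

instantiation tensor :: (complex_algebra_1, complex_algebra_1) complex_algebra_1
begin

definition one_tensor :: "('a, 'b) tensor"
  where "one_tensor = 1 \<otimes>\<^sub>t 1"

definition times_tensor :: "('a, 'b) tensor \<Rightarrow> ('a, 'b) tensor \<Rightarrow> ('a, 'b) tensor"
  where "times_tensor s t =
    tensor_lift (\<lambda>a b. tensor_lift (\<lambda>c d. (a * c) \<otimes>\<^sub>t (b * d)) t) s"

lemma cbilinear_times_inner: "cbilinear (\<lambda>c d. ((a::'a) * c) \<otimes>\<^sub>t ((b::'b) * d))"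
  by (simp add: cbilinear_iff distrib_left scaleC_mult_right pure_tensor_add_left
      pure_tensor_add_right pure_tensor_scaleC_left pure_tensor_scaleC_right)

lemma cbilinear_times_outer:
  "cbilinear (\<lambda>a b. tensor_lift (\<lambda>c d. ((a::'a) * c) \<otimes>\<^sub>t ((b::'b) * d)) t)"
proof (induction t rule: tensor_induct)
  case (pure c d)
  show ?case
    by (simp add: cbilinear_times_inner)
      (simp add: cbilinear_iff distrib_right scaleC_mult_left pure_tensor_add_left
        pure_tensor_add_right pure_tensor_scaleC_left pure_tensor_scaleC_right)
next
  case zero
  show ?case by (simp add: cbilinear_iff)
next
  case (add s t)
  then show ?case by (simp add: cbilinear_iff tensor_lift_add algebra_simps scaleC_add_right)
next
  case (scale c s)
  then show ?case
    by (simp add: cbilinear_iff tensor_lift_scaleC scaleC_add_right scaleC_scaleC mult.commute)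
qed

lemma times_pure_left:
  "(a \<otimes>\<^sub>t b) * t = tensor_lift (\<lambda>c d. ((a::'a) * c) \<otimes>\<^sub>t ((b::'b) * d)) t"
  unfolding times_tensor_def by (rule tensor_lift_pure[OF cbilinear_times_outer])

lemma times_pure: "(a \<otimes>\<^sub>t b) * (c \<otimes>\<^sub>t d) = ((a::'a) * c) \<otimes>\<^sub>t ((b::'b) * d)"
  by (simp add: times_pure_left cbilinear_times_inner)

lemma times_tensor_add_left: "((s::('a, 'b) tensor) + t) * u = s * u + t * u"
  by (simp add: times_tensor_def tensor_lift_add)

lemma times_tensor_scale_left: "(c *\<^sub>C (s::('a, 'b) tensor)) * u = c *\<^sub>C (s * u)"
  by (simp add: times_tensor_def tensor_lift_scaleC)

lemma times_tensor_zero: "0 * u = (0::('a, 'b) tensor)"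
  by (simp add: times_tensor_def)

lemma times_tensor_add_right: "u * ((s::('a, 'b) tensor) + t) = u * s + u * t"
proof (induction u rule: tensor_induct)
  case (pure a b)
  show ?case
    by (simp add: times_pure_left tensor_lift_add)
qed (simp_all add: times_tensor_add_left times_tensor_scale_left times_tensor_zero
    scaleC_add_right algebra_simps)

lemma times_tensor_scale_right: "u * (c *\<^sub>C (s::('a, 'b) tensor)) = c *\<^sub>C (u * s)"
proof (induction u rule: tensor_induct)
  case (pure a b)
  show ?case
    by (simp add: times_pure_left tensor_lift_scaleC)
qed (simp_all add: times_tensor_add_left times_tensor_scale_left times_tensor_zero
    scaleC_add_right scaleC_scaleC mult.commute)

lemma times_tensor_zero_right: "u * 0 = (0::('a, 'b) tensor)"
  using times_tensor_scale_right[of u 0 0] by simp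

lemma times_tensor_assoc: "(s * t) * u = s * (t * (u::('a, 'b) tensor))"
proof (induction s rule: tensor_induct)
  case (pure a b)
  show ?case
  proof (induction t rule: tensor_induct)
    case (pure c d)
    show ?case
    proof (induction u rule: tensor_induct)
      case (pure e f)
      show ?case by (simp add: times_pure mult.assoc)
    qed (simp_all add: times_tensor_add_right times_tensor_scale_right times_tensor_zero_right)
  qed (simp_all add: times_tensor_add_left times_tensor_scale_left times_tensor_zero
      times_tensor_add_right times_tensor_scale_right times_tensor_zero_right)
qed (simp_all add: times_tensor_add_left times_tensor_scale_left times_tensor_zero)

lemma times_tensor_one_left: "1 * (t::('a, 'b) tensor) = t"
  unfolding one_tensor_def
  by (induction t rule: tensor_induct)
    (simp_all add: times_pure times_tensor_add_right times_tensor_scale_right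
      times_tensor_zero_right)

lemma times_tensor_one_right: "(t::('a, 'b) tensor) * 1 = t"
  unfolding one_tensor_def
  by (induction t rule: tensor_induct)
    (simp_all add: times_pure times_tensor_add_left times_tensor_scale_left times_tensor_zero)

lemma zero_neq_one_tensor: "(0::('a, 'b) tensor) \<noteq> 1"
proof
  assume eq: "(0::('a, 'b) tensor) = 1"
  obtain f :: "'a \<Rightarrow> complex" where f: "clinear f" "f 1 = 1"
    using ex_clinear_functional[of "1::'a"] by auto
  obtain g :: "'b \<Rightarrow> complex" where g: "clinear g" "g 1 = 1"
    using ex_clinear_functional[of "1::'b"] by auto
  have "cbilinear (\<lambda>a b. f a * g b)"
    using f(1) g(1) by (simp add: cbilinear_iff clinear_iff algebra_simps scaleC_complex_def)
  then have "tensor_lift (\<lambda>a b. f a * g b) (1::('a, 'b) tensor) = 1"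
    using f g by (simp add: one_tensor_def)
  then show False
    by (simp flip: eq)
qed

instance
  by standard
    (simp_all add: times_tensor_assoc times_tensor_one_left times_tensor_one_right
      times_tensor_add_left times_tensor_add_right times_tensor_scale_left
      times_tensor_scale_right zero_neq_one_tensor)

end


section \<open>Universal enveloping algebras\<close>

text \<open>
  The enveloping algebra is the unital associative algebra presented by generators \<open>UGen x\<close>,
  linear in \<open>x\<close>, subject to \<open>UGen (lie x y) = UGen x * UGen y - UGen y * UGen x\<close>.
\<close>

datatype (plugins del: size) 'g uexp =
    UGen 'g
  | UZero
  | UOne
  | UAdd "'g uexp" "'g uexp"
  | UMul "'g uexp" "'g uexp"
  | UScale complex "'g uexp"

inductive ueq :: "'g::complex_lie_algebra uexp \<Rightarrow> 'g uexp \<Rightarrow> bool" where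
  refl: "ueq s s"
| sym: "ueq s t \<Longrightarrow> ueq t s"
| trans: "ueq s t \<Longrightarrow> ueq t u \<Longrightarrow> ueq s u"
| cong_add: "ueq s s' \<Longrightarrow> ueq t t' \<Longrightarrow> ueq (UAdd s t) (UAdd s' t')"
| cong_mul: "ueq s s' \<Longrightarrow> ueq t t' \<Longrightarrow> ueq (UMul s t) (UMul s' t')"
| cong_scale: "ueq s s' \<Longrightarrow> ueq (UScale c s) (UScale c s')"
| add_assoc: "ueq (UAdd (UAdd s t) u) (UAdd s (UAdd t u))"
| add_commute: "ueq (UAdd s t) (UAdd t s)"
| add_zero: "ueq (UAdd UZero s) s"
| add_inverse: "ueq (UAdd (UScale (-1) s) s) UZero"
| scale_add_right: "ueq (UScale c (UAdd s t)) (UAdd (UScale c s) (UScale c t))"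
| scale_add_left: "ueq (UScale (c + d) s) (UAdd (UScale c s) (UScale d s))"
| scale_scale: "ueq (UScale c (UScale d s)) (UScale (c * d) s)"
| scale_one: "ueq (UScale 1 s) s"
| mul_assoc: "ueq (UMul (UMul s t) u) (UMul s (UMul t u))"
| mul_one_left: "ueq (UMul UOne s) s"
| mul_one_right: "ueq (UMul s UOne) s"
| mul_add_left: "ueq (UMul (UAdd s t) u) (UAdd (UMul s u) (UMul t u))"
| mul_add_right: "ueq (UMul s (UAdd t u)) (UAdd (UMul s t) (UMul s u))"
| mul_scale_left: "ueq (UMul (UScale c s) t) (UScale c (UMul s t))"
| mul_scale_right: "ueq (UMul s (UScale c t)) (UScale c (UMul s t))"
| gen_add: "ueq (UGen (x + y)) (UAdd (UGen x) (UGen y))"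
| gen_scale: "ueq (UGen (c *\<^sub>C x)) (UScale c (UGen x))"
| gen_lie: "ueq (UGen (lie x y))
    (UAdd (UMul (UGen x) (UGen y)) (UScale (-1) (UMul (UGen y) (UGen x))))"

quotient_type (overloaded) 'g uea = "'g::complex_lie_algebra uexp" / ueq
  by (rule equivpI) (auto intro: reflpI sympI transpI ueq.refl ueq.sym ueq.trans)

lift_definition uea_gen :: "'g::complex_lie_algebra \<Rightarrow> 'g uea" is UGen .

definition lie_hom :: "('g::complex_lie_algebra \<Rightarrow> 'b::complex_algebra_1) \<Rightarrow> bool"
  where "lie_hom f \<longleftrightarrow> clinear f \<and> (\<forall>x y. f (lie x y) = f x * f y - f y * f x)"

primrec ueval :: "('g \<Rightarrow> 'b::complex_algebra_1) \<Rightarrow> 'g uexp \<Rightarrow> 'b" where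
  "ueval f (UGen x) = f x"
| "ueval f UZero = 0"
| "ueval f UOne = 1"
| "ueval f (UAdd s t) = ueval f s + ueval f t"
| "ueval f (UMul s t) = ueval f s * ueval f t"
| "ueval f (UScale c s) = c *\<^sub>C ueval f s"

lemma ueval_respects: "ueq s t \<Longrightarrow> lie_hom f \<Longrightarrow> ueval f s = ueval f t"
  by (induction rule: ueq.induct)
    (simp_all add: lie_hom_def clinear_iff scaleC_add_right scaleC_add_left scaleC_scaleC
      scaleC_one scaleC_mult_left scaleC_mult_right algebra_simps)

text \<open>
  The unital algebra homomorphism induced by a Lie algebra homomorphism \<open>f\<close>; the value for
  other \<open>f\<close> is irrelevant.
\<close>

lift_definition uea_lift ::
    "('g::complex_lie_algebra \<Rightarrow> 'b::complex_algebra_1) \<Rightarrow> 'g uea \<Rightarrow> 'b"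
  is "\<lambda>f. if lie_hom f then ueval f else (\<lambda>_. 0)"
  using ueval_respects by auto

instantiation uea :: (complex_lie_algebra) complex_algebra_1
begin

lift_definition zero_uea :: "'a uea" is UZero .
lift_definition one_uea :: "'a uea" is UOne .
lift_definition plus_uea :: "'a uea \<Rightarrow> 'a uea \<Rightarrow> 'a uea"
  is UAdd by (rule ueq.cong_add)
lift_definition times_uea :: "'a uea \<Rightarrow> 'a uea \<Rightarrow> 'a uea"
  is UMul by (rule ueq.cong_mul)
lift_definition scaleC_uea :: "complex \<Rightarrow> 'a uea \<Rightarrow> 'a uea"
  is UScale by (rule ueq.cong_scale)
lift_definition uminus_uea :: "'a uea \<Rightarrow> 'a uea"
  is "UScale (-1)" by (rule ueq.cong_scale)
lift_definition minus_uea :: "'a uea \<Rightarrow> 'a uea \<Rightarrow> 'a uea"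
  is "\<lambda>s t. UAdd s (UScale (-1) t)" by (intro ueq.cong_add ueq.cong_scale)

lemma zero_neq_one_uea: "(0::'a uea) \<noteq> 1"
proof
  assume eq: "(0::'a uea) = 1"
  have "lie_hom (\<lambda>_::'a. 0::complex)"
    by (simp add: lie_hom_def clinear_iff scaleC_complex_def)
  then have "uea_lift (\<lambda>_::'a. 0::complex) 0 = 0" "uea_lift (\<lambda>_::'a. 0::complex) 1 = 1"
    by (transfer; simp)+
  with eq show False by simp
qed

instance
proof
  show "(0::'a uea) \<noteq> 1" by (rule zero_neq_one_uea)
qed (transfer;
    rule ueq.add_assoc ueq.add_commute ueq.add_zero ueq.add_inverse ueq.refl
      ueq.scale_add_right ueq.scale_add_left ueq.scale_scale ueq.scale_one
      ueq.mul_assoc ueq.mul_one_left ueq.mul_one_right ueq.mul_add_left ueq.mul_add_right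
      ueq.mul_scale_left ueq.mul_scale_right)+

end

lemma lie_hom_uea_gen: "lie_hom uea_gen"
  unfolding lie_hom_def clinear_iff
  by (intro conjI allI; transfer) (rule ueq.gen_add ueq.gen_scale ueq.gen_lie)+

type_synonym 'g uea2 = "('g uea, 'g uea) tensor"
type_synonym 'g uea3 = "('g uea, 'g uea2) tensor"
type_synonym 'g uea4 = "('g uea, 'g uea3) tensor"

definition comult_gen :: "'g::complex_lie_algebra \<Rightarrow> 'g uea2"
  where "comult_gen x = uea_gen x \<otimes>\<^sub>t 1 + 1 \<otimes>\<^sub>t uea_gen x"

lemma lie_hom_comult_gen: "lie_hom comult_gen"
proof -
  have gen: "uea_gen (x + y) = uea_gen x + uea_gen y" "uea_gen (c *\<^sub>C x) = c *\<^sub>C uea_gen x"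
    "uea_gen (lie x y) = uea_gen x * uea_gen y - uea_gen y * uea_gen x" for x y :: 'a and c
    using lie_hom_uea_gen by (auto simp: lie_hom_def clinear_iff)
  have diff: "(a - a') \<otimes>\<^sub>t b = a \<otimes>\<^sub>t b - a' \<otimes>\<^sub>t b" "b \<otimes>\<^sub>t (a - a') = b \<otimes>\<^sub>t a - b \<otimes>\<^sub>t a'"
    for a a' b :: "'a uea"
    using pure_tensor_add_left[of "a - a'" a' b] pure_tensor_add_right[of b "a - a'" a']
    by simp_all
  show ?thesis
    unfolding lie_hom_def clinear_iff comult_gen_def gen
    by (simp add: diff pure_tensor_add_left pure_tensor_add_right pure_tensor_scaleC_left
        pure_tensor_scaleC_right scaleC_add_right times_pure algebra_simps)
qed

definition comult :: "'g::complex_lie_algebra uea \<Rightarrow> 'g uea2"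
  where "comult = uea_lift comult_gen"


section \<open>Simple Lie algebras and the Drinfeld-Jimbo r-matrix\<close>

definition simple_lie_algebra :: "'g::complex_lie_algebra itself \<Rightarrow> bool"
  where "simple_lie_algebra _ \<longleftrightarrow>
    (\<exists>B :: 'g set. finite B \<and> cvec.span B = UNIV) \<and>
    (\<exists>x y :: 'g. lie x y \<noteq> 0) \<and>
    (\<forall>I :: 'g set. cvec.subspace I \<and> (\<forall>x. \<forall>y\<in>I. lie x y \<in> I) \<longrightarrow> I = {0} \<or> I = UNIV)"

text \<open>The trace of an endomorphism of a finite-dimensional space, in an arbitrary basis.\<close>

definition trace :: "('a::complex_vector \<Rightarrow> 'a) \<Rightarrow> complex"
  where "trace f =
    (let B = (SOME B. cvec.independent B \<and> cvec.span B = (UNIV :: 'a set))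
     in \<Sum>b\<in>B. cvec.representation B (f b) b)"

definition killing_form :: "'g::complex_lie_algebra \<Rightarrow> 'g \<Rightarrow> complex"
  where "killing_form x y = trace (\<lambda>z. lie x (lie y z))"

primrec lower_central :: "'g::complex_lie_algebra set \<Rightarrow> nat \<Rightarrow> 'g set" where
  "lower_central H 0 = H"
| "lower_central H (Suc n) = cvec.span {lie x y |x y. x \<in> H \<and> y \<in> lower_central H n}"

definition cartan_subalgebra :: "'g::complex_lie_algebra set \<Rightarrow> bool"
  where "cartan_subalgebra H \<longleftrightarrow>
    cvec.subspace H \<and> (\<forall>x\<in>H. \<forall>y\<in>H. lie x y \<in> H) \<and>
    (\<exists>n. lower_central H n = {0}) \<and>
    {x. \<forall>y\<in>H. lie x y \<in> H} = H"

text \<open>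
  Linear functionals on \<open>H\<close> are represented by functions on the whole Lie algebra
  that vanish outside \<open>H\<close>, so that functionals agreeing on \<open>H\<close> are equal.
\<close>

definition root_space :: "'g::complex_lie_algebra set \<Rightarrow> ('g \<Rightarrow> complex) \<Rightarrow> 'g set"
  where "root_space H \<alpha> = {x. \<forall>y\<in>H. lie y x = \<alpha> y *\<^sub>C x}"

definition roots :: "'g::complex_lie_algebra set \<Rightarrow> ('g \<Rightarrow> complex) set"
  where "roots H = {\<alpha>.
    (\<forall>x\<in>H. \<forall>y\<in>H. \<alpha> (x + y) = \<alpha> x + \<alpha> y) \<and> (\<forall>c. \<forall>x\<in>H. \<alpha> (c *\<^sub>C x) = c * \<alpha> x) \<and>
    (\<forall>x. x \<notin> H \<longrightarrow> \<alpha> x = 0) \<and> (\<exists>x. \<alpha> x \<noteq> 0) \<and> root_space H \<alpha> \<noteq> {0}}"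

definition neg_root :: "('g \<Rightarrow> complex) \<Rightarrow> 'g \<Rightarrow> complex"
  where "neg_root \<alpha> = (\<lambda>x. - \<alpha> x)"

definition positive_roots :: "'g::complex_lie_algebra set \<Rightarrow> ('g \<Rightarrow> complex) set \<Rightarrow> bool"
  where "positive_roots H P \<longleftrightarrow>
    P \<subseteq> roots H \<and>
    (\<forall>\<alpha>\<in>roots H. (\<alpha> \<in> P) \<noteq> (neg_root \<alpha> \<in> P)) \<and>
    (\<forall>\<alpha>\<in>P. \<forall>\<beta>\<in>P. (\<lambda>x. \<alpha> x + \<beta> x) \<in> roots H \<longrightarrow> (\<lambda>x. \<alpha> x + \<beta> x) \<in> P)"

text \<open>\<open>E \<alpha>\<close> is the root vector of the root \<open>\<alpha>\<close>, for \<open>\<alpha>\<close> positive or negative.\<close>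

definition normalized_root_vectors ::
    "'g::complex_lie_algebra set \<Rightarrow> ('g \<Rightarrow> complex) set \<Rightarrow> (('g \<Rightarrow> complex) \<Rightarrow> 'g) \<Rightarrow> bool"
  where "normalized_root_vectors H P E \<longleftrightarrow>
    (\<forall>\<alpha>\<in>P. E \<alpha> \<in> root_space H \<alpha> \<and> E (neg_root \<alpha>) \<in> root_space H (neg_root \<alpha>) \<and>
       killing_form (E \<alpha>) (E (neg_root \<alpha>)) = 1)"

definition wedge2 :: "'g::complex_vector \<Rightarrow> 'g \<Rightarrow> ('g, 'g) tensor"
  where "wedge2 x y = x \<otimes>\<^sub>t y - y \<otimes>\<^sub>t x"

definition wedge3 :: "'g::complex_vector \<Rightarrow> 'g \<Rightarrow> 'g \<Rightarrow> ('g, ('g, 'g) tensor) tensor"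
  where "wedge3 x y z =
    x \<otimes>\<^sub>t y \<otimes>\<^sub>t z + y \<otimes>\<^sub>t z \<otimes>\<^sub>t x + z \<otimes>\<^sub>t x \<otimes>\<^sub>t y
    - y \<otimes>\<^sub>t x \<otimes>\<^sub>t z - x \<otimes>\<^sub>t z \<otimes>\<^sub>t y - z \<otimes>\<^sub>t y \<otimes>\<^sub>t x"

definition r_matrix ::
    "('g \<Rightarrow> complex) set \<Rightarrow> (('g \<Rightarrow> complex) \<Rightarrow> 'g::complex_lie_algebra) \<Rightarrow> ('g, 'g) tensor"
  where "r_matrix P E = (\<Sum>\<alpha>\<in>P. wedge2 (E \<alpha>) (E (neg_root \<alpha>)))"

text \<open>
  The algebraic Schouten bracket of skew-symmetric tensors. On decomposable bivectors
  \<open>schouten_tensor (wedge2 x y) (wedge2 z w)\<close> is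
  \<open>- ([x,z] \<and> y \<and> w - [x,w] \<and> y \<and> z - [y,z] \<and> x \<and> w + [y,w] \<and> x \<and> z)\<close>.
  The overall sign is the one for which the Schouten square of the bracket
  \<open>{a,b} = (t\<^sub>1 a) (t\<^sub>2 b)\<close> on an algebra is induced by the tensor
  \<open>schouten_tensor t t\<close>.
\<close>

definition schouten_tensor :: "('g::complex_lie_algebra, 'g) tensor \<Rightarrow> ('g, 'g) tensor \<Rightarrow>
    ('g, ('g, 'g) tensor) tensor"
  where "schouten_tensor s t =
    tensor_lift (\<lambda>a b. tensor_lift (\<lambda>c d. wedge3 (lie c a) b d) t) s"

abbreviation phi_tensor ::
    "('g \<Rightarrow> complex) set \<Rightarrow> (('g \<Rightarrow> complex) \<Rightarrow> 'g::complex_lie_algebra) \<Rightarrow>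
      ('g, ('g, 'g) tensor) tensor"
  where "phi_tensor P E \<equiv> schouten_tensor (r_matrix P E) (r_matrix P E)"


section \<open>The quantum group\<close>

text \<open>
  \<open>V[[h]]\<close> is the type \<open>'v fps\<close>, and the \<open>h\<close>-adically completed tensor product of
  \<open>V[[h]]\<close> and \<open>W[[h]]\<close> is \<open>('v, 'w) tensor fps\<close>. Bilinear and linear maps are extended
  \<open>h\<close>-adically by the following two operations.
\<close>

definition fps_extend :: "('a \<Rightarrow> 'b) \<Rightarrow> 'a fps \<Rightarrow> 'b fps"
  where "fps_extend f X = Abs_fps (\<lambda>n. f (X $ n))"

definition fps_extend2 :: "('a \<Rightarrow> 'b \<Rightarrow> 'c::comm_monoid_add) \<Rightarrow> 'a fps \<Rightarrow> 'b fps \<Rightarrow> 'c fps"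
  where "fps_extend2 f X Y = Abs_fps (\<lambda>n. \<Sum>i\<le>n. f (X $ i) (Y $ (n - i)))"

definition ring_inverse :: "'a::ring_1 \<Rightarrow> 'a"
  where "ring_inverse x = (THE y. x * y = 1 \<and> y * x = 1)"

definition id_comult2 :: "'g::complex_lie_algebra uea2 \<Rightarrow> 'g uea3"
  where "id_comult2 = tensor_map id comult"

definition comult_id2 :: "'g::complex_lie_algebra uea2 \<Rightarrow> 'g uea3"
  where "comult_id2 t = tensor_assoc (tensor_map comult id t)"

definition one_tensor2 :: "'g::complex_lie_algebra uea2 \<Rightarrow> 'g uea3"
  where "one_tensor2 t = 1 \<otimes>\<^sub>t t"

definition tensor2_one :: "'g::complex_lie_algebra uea2 \<Rightarrow> 'g uea3"
  where "tensor2_one t = tensor_assoc (t \<otimes>\<^sub>t 1)"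

definition id_id_comult3 :: "'g::complex_lie_algebra uea3 \<Rightarrow> 'g uea4"
  where "id_id_comult3 = tensor_map id (tensor_map id comult)"

definition comult_id_id3 :: "'g::complex_lie_algebra uea3 \<Rightarrow> 'g uea4"
  where "comult_id_id3 t = tensor_assoc (tensor_map comult id t)"

definition id_comult_id3 :: "'g::complex_lie_algebra uea3 \<Rightarrow> 'g uea4"
  where "id_comult_id3 = tensor_map id comult_id2"

definition one_tensor3 :: "'g::complex_lie_algebra uea3 \<Rightarrow> 'g uea4"
  where "one_tensor3 t = 1 \<otimes>\<^sub>t t"

definition tensor3_one :: "'g::complex_lie_algebra uea3 \<Rightarrow> 'g uea4"
  where "tensor3_one t = tensor_map id tensor_assoc (tensor_assoc (t \<otimes>\<^sub>t 1))"

definition r_uea :: "('g::complex_lie_algebra, 'g) tensor \<Rightarrow> 'g uea2"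
  where "r_uea = tensor_map uea_gen uea_gen"

definition phi_uea :: "('g::complex_lie_algebra, ('g, 'g) tensor) tensor \<Rightarrow> 'g uea3"
  where "phi_uea = tensor_map uea_gen (tensor_map uea_gen uea_gen)"

text \<open>
  Here \<open>\<Phi> = 1 \<otimes> 1 \<otimes> 1 + h\<^sup>2 \<phi> + \<cdots>\<close>. The identification of trivectors with skew-symmetric
  tensors is only determined up to a scalar. \<open>phi_tensor\<close> is normalized by the Schouten square of
  the r-matrix bracket, and in this normalization the twist equation below (with the leading
  term \<open>(h/2) r\<close>) does not allow \<open>\<phi> = phi_uea (phi_tensor P E)\<close>: it forces the factor
  \<open>-1/12\<close>. Hence this predicate is to be used with an arbitrary multiple
  \<open>\<kappa> *\<^sub>C phi_uea (phi_tensor P E)\<close>.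
\<close>

definition drinfeld_associator ::
    "'g uea3 \<Rightarrow> 'g::complex_lie_algebra uea3 fps \<Rightarrow> bool"
  where "drinfeld_associator \<phi> \<Phi> \<longleftrightarrow>
    \<Phi> $ 0 = 1 \<and> \<Phi> $ 1 = 0 \<and> \<Phi> $ 2 = \<phi> \<and>
    (\<forall>x n. let x' = uea_gen x \<otimes>\<^sub>t 1 \<otimes>\<^sub>t 1 + 1 \<otimes>\<^sub>t uea_gen x \<otimes>\<^sub>t 1 + 1 \<otimes>\<^sub>t 1 \<otimes>\<^sub>t uea_gen x
       in x' * \<Phi> $ n - \<Phi> $ n * x' = 0) \<and>
    (\<forall>b. fps_const (id_comult2 (comult b)) * \<Phi> = \<Phi> * fps_const (comult_id2 (comult b))) \<and>
    fps_extend id_id_comult3 \<Phi> * fps_extend comult_id_id3 \<Phi> =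
      fps_extend one_tensor3 \<Phi> * fps_extend id_comult_id3 \<Phi> * fps_extend tensor3_one \<Phi>"

definition drinfeld_twist ::
    "'g uea2 \<Rightarrow> 'g uea3 fps \<Rightarrow> 'g::complex_lie_algebra uea2 fps \<Rightarrow> bool"
  where "drinfeld_twist r \<Phi> F \<longleftrightarrow>
    F $ 0 = 1 \<and> F $ 1 = (1/2) *\<^sub>C r \<and>
    fps_extend one_tensor2 F * fps_extend id_comult2 F * \<Phi> *
      fps_extend comult_id2 (ring_inverse F) * ring_inverse (fps_extend tensor2_one F) = 1"

definition comult_h ::
    "'g uea2 fps \<Rightarrow> 'g::complex_lie_algebra uea fps \<Rightarrow> 'g uea2 fps"
  where "comult_h F x = F * fps_extend comult x * ring_inverse F"


section \<open>Invariant algebras, brackets and quantizations\<close>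

definition uea_module ::
    "('g::complex_lie_algebra uea \<Rightarrow> 'a::complex_vector \<Rightarrow> 'a) \<Rightarrow> bool"
  where "uea_module act \<longleftrightarrow> cbilinear act \<and> (\<forall>a. act 1 a = a) \<and>
    (\<forall>u v a. act (u * v) a = act u (act v a))"

text \<open>The induced action of the tensor square of \<open>U(\<g>)\<close> on the tensor square of the module.\<close>

definition act2 :: "('g::complex_lie_algebra uea \<Rightarrow> 'a::complex_vector \<Rightarrow> 'a) \<Rightarrow>
    'g uea2 \<Rightarrow> ('a, 'a) tensor \<Rightarrow> ('a, 'a) tensor"
  where "act2 act T t = tensor_lift (\<lambda>u v. tensor_map (act u) (act v) t) T"

definition invariant_map :: "('g::complex_lie_algebra uea \<Rightarrow> 'a::complex_vector \<Rightarrow> 'a) \<Rightarrow>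
    ('a \<Rightarrow> 'a \<Rightarrow> 'a) \<Rightarrow> bool"
  where "invariant_map act m \<longleftrightarrow>
    (\<forall>b x y. act b (m x y) = tensor_lift m (act2 act (comult b) (x \<otimes>\<^sub>t y)))"

definition invariant_algebra ::
    "('g::complex_lie_algebra uea \<Rightarrow> 'a::complex_comm_algebra \<Rightarrow> 'a) \<Rightarrow> bool"
  where "invariant_algebra act \<longleftrightarrow> uea_module act \<and> invariant_map act (*)"

definition is_bracket :: "('a::complex_comm_algebra \<Rightarrow> 'a \<Rightarrow> 'a) \<Rightarrow> bool"
  where "is_bracket f \<longleftrightarrow> cbilinear f \<and> (\<forall>a b. f a b = - f b a) \<and>
    (\<forall>a b c. f (a * b) c = a * f b c + f a c * b) \<and>
    (\<forall>a b c. f a (b * c) = f a b * c + b * f a c)"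

definition schouten_bracket ::
    "('a::complex_comm_algebra \<Rightarrow> 'a \<Rightarrow> 'a) \<Rightarrow> ('a \<Rightarrow> 'a \<Rightarrow> 'a) \<Rightarrow> 'a \<Rightarrow> 'a \<Rightarrow> 'a \<Rightarrow> 'a"
  where "schouten_bracket f g a b c =
    f (g a b) c + g (f a b) c + f (g b c) a + g (f b c) a + f (g c a) b + g (f c a) b"

definition compatible ::
    "('a::complex_comm_algebra \<Rightarrow> 'a \<Rightarrow> 'a) \<Rightarrow> ('a \<Rightarrow> 'a \<Rightarrow> 'a) \<Rightarrow> bool"
  where "compatible f g \<longleftrightarrow> (\<forall>a b c. schouten_bracket f g a b c = 0)"

definition r_bracket :: "('g::complex_lie_algebra uea \<Rightarrow> 'a::complex_comm_algebra \<Rightarrow> 'a) \<Rightarrow>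
    ('g, 'g) tensor \<Rightarrow> 'a \<Rightarrow> 'a \<Rightarrow> 'a"
  where "r_bracket act r a b = tensor_lift (\<lambda>x y. act (uea_gen x) a * act (uea_gen y) b) r"

definition phi_map :: "('g::complex_lie_algebra uea \<Rightarrow> 'a::complex_comm_algebra \<Rightarrow> 'a) \<Rightarrow>
    ('g, ('g, 'g) tensor) tensor \<Rightarrow> 'a \<Rightarrow> 'a \<Rightarrow> 'a \<Rightarrow> 'a"
  where "phi_map act \<phi> a b c =
    tensor_lift (\<lambda>x yz. act (uea_gen x) a *
      tensor_lift (\<lambda>y z. act (uea_gen y) b * act (uea_gen z) c) yz) \<phi>"

text \<open>
  A quantization is given, after transport along its isomorphism with \<open>A[[h]]\<close>, by
  an associative \<open>\<complex>[[h]]\<close>-bilinear multiplication on \<open>A[[h]]\<close> that reduces to the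
  multiplication of \<open>A\<close> modulo \<open>h\<close>.
\<close>

definition fps_bilinear :: "('a::complex_vector fps \<Rightarrow> 'a fps \<Rightarrow> 'a fps) \<Rightarrow> bool"
  where "fps_bilinear m \<longleftrightarrow>
    (\<forall>x y z. m (x + y) z = m x z + m y z) \<and> (\<forall>x y z. m x (y + z) = m x y + m x z) \<and>
    (\<forall>c x y. m (fps_extend2 scaleC c x) y = fps_extend2 scaleC c (m x y)) \<and>
    (\<forall>c x y. m x (fps_extend2 scaleC c y) = fps_extend2 scaleC c (m x y))"

definition mult_coeff :: "('a::zero fps \<Rightarrow> 'a fps \<Rightarrow> 'a fps) \<Rightarrow> nat \<Rightarrow> 'a \<Rightarrow> 'a \<Rightarrow> 'a"
  where "mult_coeff m n a b = m (fps_const a) (fps_const b) $ n"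

definition quantization ::
    "('a::complex_comm_algebra fps \<Rightarrow> 'a fps \<Rightarrow> 'a fps) \<Rightarrow> bool"
  where "quantization m \<longleftrightarrow> fps_bilinear m \<and> (\<forall>x y z. m (m x y) z = m x (m y z)) \<and>
    (\<forall>a b. mult_coeff m 0 a b = a * b)"

text \<open>The map induced by \<open>m\<close> on the completed tensor product.\<close>

definition mult_tensor ::
    "('a::complex_vector fps \<Rightarrow> 'a fps \<Rightarrow> 'a fps) \<Rightarrow> ('a, 'a) tensor fps \<Rightarrow> 'a fps"
  where "mult_tensor m T =
    Abs_fps (\<lambda>n. \<Sum>i\<le>n. tensor_lift (mult_coeff m i) (T $ (n - i)))"

text \<open>
  As the multiplication of \<open>U\<^sub>h(\<g>)\<close> is undeformed, it acts on \<open>A[[h]]\<close> by the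
  \<open>h\<close>-adic extension of the given action on \<open>A\<close>.
\<close>

definition uh_invariant :: "('g::complex_lie_algebra uea \<Rightarrow> 'a::complex_vector \<Rightarrow> 'a) \<Rightarrow>
    'g uea2 fps \<Rightarrow> ('a fps \<Rightarrow> 'a fps \<Rightarrow> 'a fps) \<Rightarrow> bool"
  where "uh_invariant act F m \<longleftrightarrow>
    (\<forall>x a b. fps_extend2 act x (m (fps_const a) (fps_const b)) =
      mult_tensor m (fps_extend2 (act2 act) (comult_h F x) (fps_const (a \<otimes>\<^sub>t b))))"

definition semiclassical_bracket ::
    "('a::complex_comm_algebra fps \<Rightarrow> 'a fps \<Rightarrow> 'a fps) \<Rightarrow> 'a \<Rightarrow> 'a \<Rightarrow> 'a"
  where "semiclassical_bracket m a b = mult_coeff m 1 a b - mult_coeff m 1 b a"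

end

theory Submission
  imports Defs
begin

text \<open>
  The bracket \<open>f\<close> has to be \<open>{a,b} + {a,b}\<^sub>r\<close>, and everything is a first or second order
  phenomenon in \<open>h\<close>.

  Invariance of \<open>f\<close> is the first order part of the \<open>U\<^sub>h(\<g>)\<close> invariance of \<open>\<mu>\<^sub>h\<close>. Modulo \<open>h\<^sup>2\<close> the
  deformed comultiplication is \<open>\<Delta>(x) + (h/2) [r, \<Delta>(x)]\<close>, so that \<open>\<mu>\<^sub>1\<close> fails to be invariant
  exactly by \<open>(1/2) \<mu> [r, \<Delta>(x)]\<close>. The map \<open>(1/2) \<mu> r\<close> fails to be invariant by the opposite
  amount, and after skew-symmetrization it becomes \<open>{a,b}\<^sub>r\<close>
  (\<open>uh_invariant_first_order\<close>, \<open>semiclassical_plus_r_bracket_invariant\<close>). It suffices to test invariance on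
  elements of the Lie algebra (\<open>invariant_map_iff_generators\<close>).

  Associativity of \<open>\<mu>\<^sub>h\<close> up to order \<open>h\<^sup>2\<close>, together with commutativity of \<open>\<mu>\<close>, makes \<open>{a,b}\<close> a
  Poisson bracket; this is the classical argument that the skew-symmetric part of a first order
  deformation is a biderivation, and that its Jacobiator is a skew-symmetrized coboundary
  (\<open>is_bracket_semiclassical_bracket\<close>, \<open>semiclassical_bracket_jacobi\<close>).

  Any invariant bracket is compatible with any r-matrix bracket: by Leibniz and invariance the
  mixed Schouten bracket is a sum of terms \<open>f(r\<^sub>1 a, b) (r\<^sub>2 c)\<close>, and these cancel because \<open>r\<close> is
  skew (\<open>r_bracket_compatible_invariant\<close>). The Schouten square of \<open>{a,b}\<^sub>r\<close> is \<open>\<phi>\<close> acting on the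
  algebra (\<open>schouten_bracket_r_bracket\<close>). Expanding the Jacobi identity of \<open>f - {a,b}\<^sub>r\<close>, where
  the mixed terms vanish, gives \<open>0 = [[f,f]] + \<phi>\<close>.
\<close>

section \<open>Linear and bilinear maps on tensor products\<close>

lemma clinearD:
  assumes "clinear f"
  shows "f (x + y) = f x + f y" "f (c *\<^sub>C x) = c *\<^sub>C f x" "f 0 = 0" "f (- x) = - f x"
    "f (x - y) = f x - f y"
proof -
  interpret Vector_Spaces.linear scaleC scaleC f by (rule assms)
  show "f (x + y) = f x + f y" "f (c *\<^sub>C x) = c *\<^sub>C f x" "f 0 = 0" "f (- x) = - f x"
    "f (x - y) = f x - f y" by (rule add scale zero neg diff)+
qed

lemma cbilinearD:
  assumes "cbilinear f"
  shows "f (x + x') y = f x y + f x' y" "f x (y + y') = f x y + f x y'"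
    "f (c *\<^sub>C x) y = c *\<^sub>C f x y" "f x (c *\<^sub>C y) = c *\<^sub>C f x y"
    "f 0 y = 0" "f x 0 = 0" "f (- x) y = - f x y" "f x (- y) = - f x y"
    "f (x - x') y = f x y - f x' y" "f x (y - y') = f x y - f x y'"
proof -
  have l: "clinear (f x)" "clinear (\<lambda>x. f x y)" for x y
    using assms by (simp_all add: cbilinear_def)
  show "f (x + x') y = f x y + f x' y" "f x (y + y') = f x y + f x y'"
    "f (c *\<^sub>C x) y = c *\<^sub>C f x y" "f x (c *\<^sub>C y) = c *\<^sub>C f x y"
    "f 0 y = 0" "f x 0 = 0" "f (- x) y = - f x y" "f x (- y) = - f x y"
    "f (x - x') y = f x y - f x' y" "f x (y - y') = f x y - f x y'"
    by (rule clinearD[OF l(1)] clinearD[OF l(2)])+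
qed

lemma cbilinear_times: "cbilinear ((*) :: 'a::complex_algebra \<Rightarrow> 'a \<Rightarrow> 'a)"
  by (simp add: cbilinear_iff algebra_simps scaleC_mult_left scaleC_mult_right)

lemmas tensor_lift_linear [simp] = clinearD[OF clinear_tensor_lift]

lemma tensor_map_pure:
  assumes "clinear f" "clinear g"
  shows "tensor_map f g (a \<otimes>\<^sub>t b) = f a \<otimes>\<^sub>t g b"
proof -
  have "cbilinear (\<lambda>a b. f a \<otimes>\<^sub>t g b)"
    by (simp add: cbilinear_iff assms[THEN clinearD(1)] assms[THEN clinearD(2)]
        pure_tensor_add_left pure_tensor_add_right pure_tensor_scaleC_left pure_tensor_scaleC_right)
  then show ?thesis by (simp add: tensor_map_def)
qed

section \<open>The enveloping algebra and its action on a tensor square\<close>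

lemma uea_induct [case_names gen zero one add mult scale]:
  assumes "\<And>x. Q (uea_gen x)" "Q 0" "Q 1" "\<And>u v. Q u \<Longrightarrow> Q v \<Longrightarrow> Q (u + v)"
    "\<And>u v. Q u \<Longrightarrow> Q v \<Longrightarrow> Q (u * v)" "\<And>c u. Q u \<Longrightarrow> Q (c *\<^sub>C u)"
  shows "Q u"
proof (induction u rule: uea.abs_induct)
  case (1 e)
  show ?case
    using assms
    by (induction e) (simp_all flip: uea_gen.abs_eq zero_uea.abs_eq one_uea.abs_eq
        plus_uea.abs_eq times_uea.abs_eq scaleC_uea.abs_eq)
qed

lemma uea_lift_simps:
  assumes "lie_hom f"
  shows "uea_lift f (uea_gen x) = f x" "uea_lift f 0 = 0" "uea_lift f 1 = 1"
    "uea_lift f (u + v) = uea_lift f u + uea_lift f v"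
    "uea_lift f (u * v) = uea_lift f u * uea_lift f v"
    "uea_lift f (c *\<^sub>C u) = c *\<^sub>C uea_lift f u"
  using assms by (transfer, simp)+

lemma comult_simps [simp]:
  "comult (uea_gen x) = uea_gen x \<otimes>\<^sub>t 1 + 1 \<otimes>\<^sub>t uea_gen x"
  "comult 0 = 0" "comult 1 = 1 \<otimes>\<^sub>t 1" "comult (u + v) = comult u + comult v"
  "comult (u * v) = comult u * comult v" "comult (c *\<^sub>C u) = c *\<^sub>C comult u"
  by (simp_all add: comult_def uea_lift_simps[OF lie_hom_comult_gen] comult_gen_def one_tensor_def)

lemma uea_gen_simps:
  "uea_gen (x + y) = uea_gen x + uea_gen y" "uea_gen (c *\<^sub>C x) = c *\<^sub>C uea_gen x"
  "uea_gen (lie x y) = uea_gen x * uea_gen y - uea_gen y * uea_gen x"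
  using lie_hom_uea_gen by (auto simp: lie_hom_def clinear_iff)

lemma clinear_uea_gen: "clinear uea_gen"
  by (rule lie_hom_uea_gen[unfolded lie_hom_def, THEN conjunct1])

lemma uea_moduleD:
  assumes "uea_module act"
  shows "cbilinear act" "clinear (act u)" "act 1 a = a" "act (u * v) a = act u (act v a)"
  using assms by (auto simp: uea_module_def cbilinear_def)

lemma act2_zero_left: "act2 act 0 t = 0"
  and act2_add_left: "act2 act (S + T) t = act2 act S t + act2 act T t"
  and act2_scaleC_left: "act2 act (c *\<^sub>C S) t = c *\<^sub>C act2 act S t"
  and act2_diff_left: "act2 act (S - T) t = act2 act S t - act2 act T t"
  by (simp_all add: act2_def)

lemma act2_pure_left:
  assumes "uea_module act"
  shows "act2 act (u \<otimes>\<^sub>t v) t = tensor_map (act u) (act v) t"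
proof -
  note bil = cbilinearD[OF uea_moduleD(1)[OF assms]]
  have "cbilinear (\<lambda>u v. tensor_map (act u) (act v) t)"
  proof (induction t rule: tensor_induct)
    case (pure a b)
    show ?case
      by (simp add: tensor_map_pure uea_moduleD(2)[OF assms])
        (simp add: cbilinear_iff bil
        pure_tensor_add_left pure_tensor_add_right pure_tensor_scaleC_left pure_tensor_scaleC_right)
  qed (simp_all add: tensor_map_def cbilinear_iff scaleC_add_right scaleC_scaleC mult.commute)
  then show ?thesis by (simp add: act2_def)
qed

lemma act2_pure:
  assumes "uea_module act"
  shows "act2 act (u \<otimes>\<^sub>t v) (a \<otimes>\<^sub>t b) = act u a \<otimes>\<^sub>t act v b"
  by (simp add: act2_pure_left assms tensor_map_pure uea_moduleD(2))

lemma act2_right: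
  assumes "uea_module act"
  shows act2_zero_right: "act2 act T 0 = 0"
    and act2_add_right: "act2 act T (s + t) = act2 act T s + act2 act T t"
    and act2_scaleC_right: "act2 act T (c *\<^sub>C s) = c *\<^sub>C act2 act T s"
  by (induction T rule: tensor_induct)
    (simp_all add: act2_zero_left act2_add_left act2_scaleC_left act2_pure_left[OF assms]
      tensor_map_def scaleC_add_right scaleC_scaleC mult.commute)

lemma act2_mult:
  assumes "uea_module act"
  shows "act2 act (S * T) t = act2 act S (act2 act T t)"
proof (induction t rule: tensor_induct)
  case (pure a b)
  show ?case
  proof (induction S rule: tensor_induct)
    case (pure u v)
    show ?case
    proof (induction T rule: tensor_induct)
      case (pure u' v')
      show ?case by (simp add: times_pure act2_pure assms uea_moduleD(4))
    qed (simp_all add: distrib_left times_tensor_scale_right act2_right[OF assms]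
        act2_add_left act2_scaleC_left act2_zero_left)
  qed (simp_all add: distrib_right times_tensor_scale_left act2_zero_left act2_add_left
      act2_scaleC_left)
qed (simp_all add: act2_right[OF assms])

text \<open>
  Both sides of the invariance condition are multiplicative in the acting element, because \<open>\<Delta>\<close> is
  an algebra homomorphism and \<open>act2\<close> is an action. Hence it is enough that every \<open>x \<in> \<g>\<close> satisfies
  the Leibniz rule with respect to \<open>m\<close>. For \<open>m = (*)\<close> this says that \<open>\<g>\<close> acts by derivations.
\<close>

lemma invariant_map_iff_generators:
  assumes act: "uea_module act" and m: "cbilinear m"
  shows "invariant_map act m \<longleftrightarrow>
    (\<forall>x a b. act (uea_gen x) (m a b) = m (act (uea_gen x) a) b + m a (act (uea_gen x) b))"
    (is "_ \<longleftrightarrow> ?gen")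
proof
  have expand: "tensor_lift m (act2 act (comult (uea_gen x)) (a \<otimes>\<^sub>t b)) =
      m (act (uea_gen x) a) b + m a (act (uea_gen x) b)" for x a b
    by (simp add: act2_add_left act2_pure act m uea_moduleD(3))
  show "invariant_map act m \<Longrightarrow> ?gen"
    by (simp add: invariant_map_def expand del: comult_simps)
  assume ?gen
  note bil = cbilinearD[OF uea_moduleD(1)[OF act]]
  note lin = clinearD[OF uea_moduleD(2)[OF act]]
  have "act u (tensor_lift m t) = tensor_lift m (act2 act (comult u) t)" for u t
  proof (induction u arbitrary: t rule: uea_induct)
    case (gen x)
    show ?case
    proof (induction t rule: tensor_induct)
      case (pure a b)
      show ?case using \<open>?gen\<close> by (simp only: expand tensor_lift_pure[OF m])
    qed (simp_all add: lin act2_right[OF act] del: comult_simps)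
  next
    case one
    have "act2 act (1 \<otimes>\<^sub>t 1) t = t"
      by (induction t rule: tensor_induct)
        (simp_all add: act2_pure act uea_moduleD(3) act2_right[OF act])
    then show ?case by (simp add: uea_moduleD(3)[OF act])
  qed (simp_all add: bil act2_zero_left act2_add_left act2_scaleC_left act2_mult[OF act]
      uea_moduleD(4)[OF act])
  from this[of _ "_ \<otimes>\<^sub>t _"] show "invariant_map act m"
    by (simp add: invariant_map_def m)
qed

lemma invariant_map_tensor:
  assumes "uea_module act" "cbilinear m" "invariant_map act m"
  shows "act u (tensor_lift m t) = tensor_lift m (act2 act (comult u) t)"
  using assms(3)
  by (induction t rule: tensor_induct)
    (simp_all add: invariant_map_def assms act2_right clinearD[OF uea_moduleD(2)])

section \<open>Brackets and their Schouten brackets\<close>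

lemma is_bracketD:
  assumes "is_bracket f"
  shows "cbilinear f" "f a b = - f b a" "f (a * b) c = a * f b c + f a c * b"
    "f a (b * c) = f a b * c + b * f a c"
  using assms unfolding is_bracket_def by blast+

lemma is_bracketI:
  assumes "cbilinear f" and skew: "\<And>a b. f a b = - f b a"
    and leibniz: "\<And>a b c. f (a * b) c = a * f b c + f a c * b"
  shows "is_bracket f"
proof -
  have "f a (b * c) = f a b * c + b * f a c" for a b c
    unfolding skew[of a] leibniz by (simp add: algebra_simps)
  then show ?thesis
    unfolding is_bracket_def using assms by blast
qed

lemma is_bracket_add:
  assumes f: "is_bracket f" and g: "is_bracket g"
  shows "is_bracket (\<lambda>a b. f a b + g a b)"
proof -
  have "cbilinear (\<lambda>a b. f a b + g a b)"
    using is_bracketD(1)[OF f] is_bracketD(1)[OF g] by (simp add: cbilinear_iff scaleC_add_right)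
  moreover have "f a b + g a b = - (f b a + g b a)" for a b
    using is_bracketD(2)[OF f, of a b] is_bracketD(2)[OF g, of a b] by simp
  moreover have "f (a * b) c + g (a * b) c = a * (f b c + g b c) + (f a c + g a c) * b" for a b c
    by (simp add: is_bracketD(3)[OF f] is_bracketD(3)[OF g] algebra_simps)
  ultimately show ?thesis by (rule is_bracketI)
qed

lemma schouten_bracket_diff:
  assumes "cbilinear f" "cbilinear g" and "compatible f g"
  shows "schouten_bracket (\<lambda>a b. f a b - g a b) (\<lambda>a b. f a b - g a b) a b c =
    schouten_bracket f f a b c + schouten_bracket g g a b c"
proof -
  have "schouten_bracket (\<lambda>a b. f a b - g a b) (\<lambda>a b. f a b - g a b) a b c =
    schouten_bracket f f a b c + schouten_bracket g g a b c
    - schouten_bracket f g a b c - schouten_bracket f g a b c"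
    unfolding schouten_bracket_def cbilinearD[OF assms(1)] cbilinearD[OF assms(2)]
    by (simp add: algebra_simps)
  then show ?thesis using assms(3) by (simp add: compatible_def)
qed

section \<open>The Poisson bracket of a quantization\<close>

lemma scale_fps_const_nth [simp]: "fps_extend2 scaleC (fps_const c) X $ n = c *\<^sub>C X $ n"
proof -
  have "(\<Sum>i\<le>n. (fps_const c $ i) *\<^sub>C X $ (n - i)) = (\<Sum>i\<in>{0}. (fps_const c $ i) *\<^sub>C X $ (n - i))"
    by (rule sum.mono_neutral_right) auto
  then show ?thesis by (simp add: fps_extend2_def)
qed

lemma scale_fps_X_nth [simp]:
  "fps_extend2 scaleC fps_X X $ n = (if n = 0 then 0 else X $ (n - 1))"
proof -
  have "(\<Sum>i\<le>n. (fps_X $ i) *\<^sub>C X $ (n - i)) = (\<Sum>i\<in>{1} \<inter> {..n}. (fps_X $ i) *\<^sub>C X $ (n - i))"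
    by (rule sum.mono_neutral_right) auto
  also have "\<dots> = (if n = 0 then 0 else X $ (n - 1))"
    by (cases n) (simp_all add: scaleC_one)
  finally show ?thesis by (simp add: fps_extend2_def)
qed

lemma fps_split_constant_term: "X = fps_const (X $ 0) + fps_extend2 scaleC fps_X (fps_shift 1 X)"
  by (rule fps_ext) simp

text \<open>
  Splitting off the constant term and pulling out the factor \<open>h\<close> by \<open>\<complex>[[h]]\<close>-linearity, again and
  again, determines every coefficient after finitely many steps. So a \<open>\<complex>[[h]]\<close>-bilinear
  multiplication is \<open>h\<close>-adically continuous, and equations between its values can be compared
  coefficient by coefficient.
\<close>

lemma fps_bilinear_nth_left:
  assumes "fps_bilinear m"
  shows "m X (fps_const b) $ n = (\<Sum>i\<le>n. mult_coeff m i (X $ (n - i)) b)"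
proof (induction n arbitrary: X)
  have split: "m X (fps_const b) = m (fps_const (X $ 0)) (fps_const b) +
      fps_extend2 scaleC fps_X (m (fps_shift 1 X) (fps_const b))" for X
    using assms by (subst fps_split_constant_term[of X]) (simp add: fps_bilinear_def)
  {
    case 0
    show ?case by (subst split) (simp add: mult_coeff_def)
  next
    case (Suc n)
    have "(\<Sum>i\<le>n. mult_coeff m i (X $ (n - i + 1)) b) =
        (\<Sum>i\<le>n. mult_coeff m i (X $ (Suc n - i)) b)"
      by (rule sum.cong) (simp_all add: Suc_diff_le)
    then show ?case by (subst split) (simp add: mult_coeff_def[symmetric] Suc)
  }
qed

lemma fps_bilinear_nth_right:
  assumes "fps_bilinear m"
  shows "m (fps_const a) X $ n = (\<Sum>i\<le>n. mult_coeff m i a (X $ (n - i)))"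
proof -
  have "fps_bilinear (\<lambda>x y. m y x)"
    using assms by (auto simp: fps_bilinear_def)
  from fps_bilinear_nth_left[OF this, where X=X and b=a and n=n] show ?thesis
    by (simp add: mult_coeff_def)
qed

lemma cbilinear_mult_coeff:
  assumes "fps_bilinear m"
  shows "cbilinear (mult_coeff m n)"
proof -
  have "fps_const (c *\<^sub>C a) = fps_extend2 scaleC (fps_const c) (fps_const a)" for c and a :: 'a
    by (rule fps_ext) simp
  then show ?thesis
    using assms by (simp add: cbilinear_iff mult_coeff_def fps_bilinear_def flip: fps_const_add)
qed

context
  fixes m :: "'a::complex_comm_algebra fps \<Rightarrow> 'a fps \<Rightarrow> 'a fps"
  assumes quant: "quantization m"
begin

lemma quantization_bilinear: "fps_bilinear m"
  using quant by (simp add: quantization_def)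

lemma mult_coeff_0: "mult_coeff m 0 a b = a * b"
  using quant by (simp add: quantization_def)

lemma mult_coeff_assoc:
  "(\<Sum>i\<le>n. mult_coeff m i (mult_coeff m (n - i) a b) c) =
    (\<Sum>i\<le>n. mult_coeff m i a (mult_coeff m (n - i) b c))"
proof -
  have "m (m (fps_const a) (fps_const b)) (fps_const c) $ n =
      m (fps_const a) (m (fps_const b) (fps_const c)) $ n"
    using quant by (simp add: quantization_def)
  then show ?thesis
    by (simp add: fps_bilinear_nth_left fps_bilinear_nth_right quantization_bilinear
        flip: mult_coeff_def)
qed

text \<open>
  The first order part of associativity says that \<open>\<mu>\<^sub>1\<close> is a Hochschild cocycle.
\<close>

lemma mult_coeff_1_hochschild:
  "mult_coeff m 1 a b * c + mult_coeff m 1 (a * b) c =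
    a * mult_coeff m 1 b c + mult_coeff m 1 a (b * c)"
  using mult_coeff_assoc[where n=1 and a=a and b=b and c=c]
  by (simp add: mult_coeff_0)

text \<open>
  In second order, the associator of \<open>\<mu>\<^sub>1\<close> is the Hochschild coboundary of \<open>\<mu>\<^sub>2\<close>.
\<close>

lemma mult_coeff_2_hochschild:
  "mult_coeff m 2 a b * c + mult_coeff m 1 (mult_coeff m 1 a b) c + mult_coeff m 2 (a * b) c =
    a * mult_coeff m 2 b c + mult_coeff m 1 a (mult_coeff m 1 b c) + mult_coeff m 2 a (b * c)"
  using mult_coeff_assoc[where n=2 and a=a and b=b and c=c]
  by (simp add: mult_coeff_0 numeral_2_eq_2)

lemmas mult_coeff_bilinear = cbilinearD[OF cbilinear_mult_coeff[OF quantization_bilinear]]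

text \<open>
  The Leibniz rule is the alternating sum of the cocycle condition for \<open>\<mu>\<^sub>1\<close> at \<open>(a,b,c)\<close>, \<open>(a,c,b)\<close>
  and \<open>(c,a,b)\<close>: since \<open>\<mu>\<close> is commutative, the terms \<open>\<mu>\<^sub>1(a,bc)\<close> and \<open>\<mu>\<^sub>1(ac,b)\<close> occur twice
  each, with opposite signs.
\<close>

lemma is_bracket_semiclassical_bracket: "is_bracket (semiclassical_bracket m)"
proof -
  let ?p = "semiclassical_bracket m"
  have "?p (a * b) c = a * ?p b c + ?p a c * b" for a b c
  proof -
    have e1: "mult_coeff m 1 (a * b) c =
        a * mult_coeff m 1 b c + mult_coeff m 1 a (b * c) - mult_coeff m 1 a b * c"
      using mult_coeff_1_hochschild[of a b c] by (simp add: algebra_simps)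
    have e2: "mult_coeff m 1 a (b * c) =
        mult_coeff m 1 a c * b + mult_coeff m 1 (a * c) b - a * mult_coeff m 1 c b"
      using mult_coeff_1_hochschild[of a c b] by (simp add: algebra_simps)
    have e3: "mult_coeff m 1 c (a * b) =
        mult_coeff m 1 c a * b + mult_coeff m 1 (a * c) b - c * mult_coeff m 1 a b"
      using mult_coeff_1_hochschild[of c a b] by (simp add: algebra_simps)
    show ?thesis
      unfolding semiclassical_bracket_def e1 e2 e3 by (simp add: algebra_simps)
  qed
  moreover have "?p a b = - ?p b a" for a b
    by (simp add: semiclassical_bracket_def)
  moreover have "cbilinear ?p"
    unfolding cbilinear_iff semiclassical_bracket_def
    by (simp add: mult_coeff_bilinear cvec.scale_right_diff_distrib)
  ultimately show ?thesis by (intro is_bracketI)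
qed

text \<open>
  The Jacobiator of the commutator of \<open>\<mu>\<^sub>1\<close> is the skew-symmetrized associator of \<open>\<mu>\<^sub>1\<close>. The associator
  is a coboundary, and coboundaries of a commutative algebra have zero skew-symmetrization.
\<close>

lemma semiclassical_bracket_jacobi:
  "schouten_bracket (semiclassical_bracket m) (semiclassical_bracket m) a b c = 0"
proof -
  let ?p = "semiclassical_bracket m"
  define as where "as a b c =
    mult_coeff m 1 (mult_coeff m 1 a b) c - mult_coeff m 1 a (mult_coeff m 1 b c)" for a b c
  have coboundary: "as a b c = a * mult_coeff m 2 b c - mult_coeff m 2 (a * b) c
      + mult_coeff m 2 a (b * c) - mult_coeff m 2 a b * c" for a b c
    using mult_coeff_2_hochschild[of a b c] unfolding as_def by (simp add: algebra_simps)
  have "as a b c + as b c a + as c a b - as b a c - as a c b - as c b a = 0"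
    unfolding coboundary by (simp add: algebra_simps)
  then have jacobi: "?p (?p a b) c + ?p (?p b c) a + ?p (?p c a) b = 0"
    unfolding as_def semiclassical_bracket_def by (simp add: mult_coeff_bilinear algebra_simps)
  have "schouten_bracket ?p ?p a b c =
      (?p (?p a b) c + ?p (?p b c) a + ?p (?p c a) b) +
      (?p (?p a b) c + ?p (?p b c) a + ?p (?p c a) b)"
    by (simp only: schouten_bracket_def add_ac)
  then show ?thesis by (simp only: jacobi add_0)
qed

end

section \<open>The r-matrix bracket\<close>

text \<open>
  Identities that hold for skew-symmetric tensors only cannot be proved by induction on tensors, whose
  base case is a pure tensor. Here the base case is a decomposable bivector instead.
\<close>

lemma r_matrix_induct [case_names zero wedge add]:
  assumes "Q 0" "\<And>x y. Q (wedge2 x y)" "\<And>s t. Q s \<Longrightarrow> Q t \<Longrightarrow> Q (s + t)"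
  shows "Q (r_matrix P E)"
  unfolding r_matrix_def
  by (induction P rule: infinite_finite_induct) (use assms in simp_all)

text \<open>
  \<open>schouten_tensor\<close> is a nested lift, which is meaningful once the two maps lifted are known to be
  bilinear.
\<close>

lemma cbilinear_schouten_inner: "cbilinear (\<lambda>c d. wedge3 (lie c a) b d)"
  unfolding cbilinear_iff wedge3_def lie_add_left lie_scaleC_left pure_tensor_add_left
    pure_tensor_add_right pure_tensor_scaleC_left pure_tensor_scaleC_right
  by (simp add: scaleC_add_right cvec.scale_right_diff_distrib)

lemma cbilinear_schouten_outer:
  "cbilinear (\<lambda>a b. tensor_lift (\<lambda>c d. wedge3 (lie c a) b d) t)"
proof (induction t rule: tensor_induct)
  case (pure c d)
  show ?case
    unfolding tensor_lift_pure[OF cbilinear_schouten_inner]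
    unfolding cbilinear_iff wedge3_def lie_add_right lie_scaleC_right pure_tensor_add_left
      pure_tensor_add_right pure_tensor_scaleC_left pure_tensor_scaleC_right
    by (simp add: scaleC_add_right cvec.scale_right_diff_distrib)
qed (simp_all add: cbilinear_iff scaleC_add_right scaleC_scaleC mult.commute)

lemma schouten_tensor_pure_left:
  "schouten_tensor (x \<otimes>\<^sub>t y) t = tensor_lift (\<lambda>c d. wedge3 (lie c x) y d) t"
  unfolding schouten_tensor_def by (rule tensor_lift_pure[OF cbilinear_schouten_outer])

lemma schouten_tensor_pure:
  "schouten_tensor (x \<otimes>\<^sub>t y) (z \<otimes>\<^sub>t w) = wedge3 (lie z x) y w"
  unfolding schouten_tensor_pure_left by (rule tensor_lift_pure[OF cbilinear_schouten_inner])

lemma cbilinear_schouten_tensor: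
  "cbilinear (schouten_tensor :: ('g::complex_lie_algebra, 'g) tensor \<Rightarrow> _)"
proof -
  have left: "schouten_tensor 0 t = 0"
    "schouten_tensor (s + s') t = schouten_tensor s t + schouten_tensor s' t"
    "schouten_tensor (c *\<^sub>C s) t = c *\<^sub>C schouten_tensor s t"
    for s s' t :: "('g, 'g) tensor" and c
    by (simp_all add: schouten_tensor_def)
  moreover have "schouten_tensor s (t + t') = schouten_tensor s t + schouten_tensor s t'"
    "schouten_tensor s (c *\<^sub>C t) = c *\<^sub>C schouten_tensor s t" for s t t' :: "('g, 'g) tensor" and c
    by (induction s rule: tensor_induct)
      (simp_all add: schouten_tensor_pure_left left scaleC_add_right scaleC_scaleC mult.commute)
  ultimately show ?thesis
    by (simp add: cbilinear_iff)
qed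

context
  fixes act :: "'g::complex_lie_algebra uea \<Rightarrow> 'a::complex_comm_algebra \<Rightarrow> 'a"
  assumes inv: "invariant_algebra act"
begin

lemma module_act: "uea_module act"
  using inv by (simp add: invariant_algebra_def)

lemmas act_bilinear = cbilinearD[OF uea_moduleD(1)[OF module_act]]

lemma act_gen_mult:
  "act (uea_gen x) (a * b) = act (uea_gen x) a * b + a * act (uea_gen x) b"
  using inv invariant_map_iff_generators[OF module_act cbilinear_times]
  by (simp add: invariant_algebra_def)

lemma act_gen_lie:
  "act (uea_gen (lie x y)) a =
    act (uea_gen x) (act (uea_gen y) a) - act (uea_gen y) (act (uea_gen x) a)"
  by (simp add: uea_gen_simps act_bilinear uea_moduleD(4)[OF module_act])

lemma r_bracket_pure:
  "r_bracket act (x \<otimes>\<^sub>t y) a b = act (uea_gen x) a * act (uea_gen y) b"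
  unfolding r_bracket_def
  by (rule tensor_lift_pure)
    (simp add: cbilinear_iff uea_gen_simps act_bilinear algebra_simps
        scaleC_mult_left scaleC_mult_right)

lemma r_bracket_wedge2:
  "r_bracket act (wedge2 x y) a b =
    act (uea_gen x) a * act (uea_gen y) b - act (uea_gen y) a * act (uea_gen x) b"
proof -
  have "r_bracket act (wedge2 x y) a b = r_bracket act (x \<otimes>\<^sub>t y) a b - r_bracket act (y \<otimes>\<^sub>t x) a b"
    by (simp add: r_bracket_def wedge2_def)
  then show ?thesis by (simp add: r_bracket_pure)
qed

lemma r_bracket_zero: "r_bracket act 0 a b = 0"
  and r_bracket_add: "r_bracket act (s + t) a b = r_bracket act s a b + r_bracket act t a b"
  by (simp_all add: r_bracket_def)

lemma cbilinear_r_bracket: "cbilinear (r_bracket act r)"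
proof (induction r rule: tensor_induct)
  case (pure x y)
  show ?case
    by (simp add: cbilinear_iff r_bracket_pure act_bilinear algebra_simps scaleC_mult_left
        scaleC_mult_right)
next
  case zero
  show ?case by (simp add: cbilinear_iff r_bracket_def)
next
  case (add s t)
  then show ?case by (simp add: cbilinear_iff r_bracket_def scaleC_add_right)
next
  case (scale c s)
  then show ?case
    by (simp add: cbilinear_iff r_bracket_def scaleC_add_right scaleC_scaleC mult.commute)
qed

lemma is_bracket_r_bracket: "is_bracket (r_bracket act (r_matrix P E))"
proof (induction P E rule: r_matrix_induct)
  case zero
  show ?case by (simp add: is_bracket_def cbilinear_iff r_bracket_zero)
next
  case (wedge x y)
  let ?r = "r_bracket act (wedge2 x y)"
  note cbilinear_r_bracket
  moreover have "?r a b = - ?r b a" for a b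
    by (simp add: r_bracket_wedge2 mult.commute)
  moreover have "?r (a * b) c = a * ?r b c + ?r a c * b" for a b c
    unfolding r_bracket_wedge2 act_gen_mult by (simp add: algebra_simps)
  ultimately show ?case by (rule is_bracketI)
next
  case (add s t)
  have "is_bracket (\<lambda>a b. r_bracket act s a b + r_bracket act t a b)"
    by (rule is_bracket_add add)+
  moreover have "r_bracket act (s + t) = (\<lambda>a b. r_bracket act s a b + r_bracket act t a b)"
    by (intro ext) (rule r_bracket_add)
  ultimately show ?case by (simp only:)
qed

text \<open>
  By invariance \<open>{f(a,b),c}\<^sub>r\<close> is the sum of \<open>f(r\<^sub>1 a, b) (r\<^sub>2 c)\<close> and \<open>f(a, r\<^sub>1 b) (r\<^sub>2 c)\<close>, and by the Leibniz
  rule \<open>f({a,b}\<^sub>r,c)\<close> is the sum of \<open>(r\<^sub>1 a) f(r\<^sub>2 b, c)\<close> and \<open>f(r\<^sub>1 a, c) (r\<^sub>2 b)\<close>. In the cyclic sum these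
  cancel in pairs, by skewness of \<open>r\<close> and of \<open>f\<close>.
\<close>

lemma r_bracket_compatible_invariant:
  assumes f: "is_bracket f" and inv_f: "invariant_map act f"
  shows "compatible f (r_bracket act (r_matrix P E))"
proof (induction P E rule: r_matrix_induct)
  case zero
  show ?case
    by (simp add: compatible_def schouten_bracket_def r_bracket_zero
        cbilinearD[OF is_bracketD(1)[OF f]])
next
  case (wedge x y)
  note bil = is_bracketD(1)[OF f] and leib = is_bracketD(3)[OF f]
  have gen: "act (uea_gen x) (f a b) = f (act (uea_gen x) a) b + f a (act (uea_gen x) b)"
    for x a b
    using inv_f by (simp add: invariant_map_iff_generators[OF module_act bil])
  \<comment> \<open>Moving the differentiated argument to the front makes the cancelling terms syntactically equal.\<close>
  have sk: "f u (act (uea_gen z) v) = - f (act (uea_gen z) v) u" for u v z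
    by (rule is_bracketD(2)[OF f])
  have "schouten_bracket f (r_bracket act (wedge2 x y)) a b c = 0" for a b c
    unfolding schouten_bracket_def r_bracket_wedge2 gen cbilinearD[OF bil] leib sk
    by (simp add: algebra_simps)
  then show ?case by (simp add: compatible_def)
next
  case (add s t)
  note bil = is_bracketD(1)[OF f]
  have "schouten_bracket f (r_bracket act (s + t)) a b c =
      schouten_bracket f (r_bracket act s) a b c + schouten_bracket f (r_bracket act t) a b c"
    for a b c
    unfolding schouten_bracket_def r_bracket_add cbilinearD[OF bil] by (simp add: algebra_simps)
  then show ?case using add by (simp add: compatible_def)
qed

lemma phi_map_wedge3:
  "phi_map act (wedge3 x y z) a b c =
  (let D = \<lambda>x. act (uea_gen x) in
   D x a * D y b * D z c + D y a * D z b * D x c + D z a * D x b * D y c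
   - D y a * D x b * D z c - D x a * D z b * D y c - D z a * D y b * D x c)"
proof -
  have bil: "cbilinear (\<lambda>y z. act (uea_gen y) b * act (uea_gen z) c)"
    by (simp add: cbilinear_iff uea_gen_simps act_bilinear algebra_simps
        scaleC_mult_left scaleC_mult_right)
  have "cbilinear (\<lambda>x yz. act (uea_gen x) a *
      tensor_lift (\<lambda>y z. act (uea_gen y) b * act (uea_gen z) c) yz)"
    by (simp add: cbilinear_iff uea_gen_simps act_bilinear algebra_simps
        scaleC_mult_left scaleC_mult_right)
  then have "phi_map act (x \<otimes>\<^sub>t y \<otimes>\<^sub>t z) a b c =
      act (uea_gen x) a * act (uea_gen y) b * act (uea_gen z) c" for x y z
    unfolding phi_map_def by (simp add: tensor_lift_pure bil mult.assoc)
  then show ?thesis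
    unfolding wedge3_def Let_def by (simp add: phi_map_def)
qed

text \<open>
  The Lie algebra acts by derivations, so each outer bracket differentiates both factors of the
  products in the inner one. This produces second order operators such as \<open>z x\<close> acting on one
  argument; in the cyclic sum they occur only in combinations \<open>z x - x z\<close>, which are the actions of
  Lie brackets.
\<close>

lemma schouten_bracket_wedge2:
  "schouten_bracket (r_bracket act (wedge2 x y)) (r_bracket act (wedge2 z w)) a b c =
    phi_map act (schouten_tensor (wedge2 x y) (wedge2 z w)) a b c"
proof -
  have diff: "phi_map act (s - t) a b c = phi_map act s a b c - phi_map act t a b c" for s t
    by (simp add: phi_map_def)
  show ?thesis
    unfolding schouten_bracket_def r_bracket_wedge2
    unfolding wedge2_def cbilinearD[OF cbilinear_schouten_tensor] schouten_tensor_pure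
      diff phi_map_wedge3 Let_def act_gen_lie act_gen_mult act_bilinear
    by (simp add: algebra_simps)
qed

lemma schouten_bracket_r_bracket:
  "schouten_bracket (r_bracket act (r_matrix P E)) (r_bracket act (r_matrix Q G)) a b c =
    phi_map act (schouten_tensor (r_matrix P E) (r_matrix Q G)) a b c"
proof -
  have phi_add: "phi_map act (s + t) a b c = phi_map act s a b c + phi_map act t a b c"
    and phi_zero: "phi_map act 0 a b c = 0" for s t
    by (simp_all add: phi_map_def)
  note bil = cbilinearD[OF cbilinear_schouten_tensor]
  note r_bil = cbilinearD[OF cbilinear_r_bracket]
  define agree where "agree s t \<longleftrightarrow>
    schouten_bracket (r_bracket act s) (r_bracket act t) a b c =
    phi_map act (schouten_tensor s t) a b c" for s t
  have zero: "agree 0 t" "agree s 0" for s t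
    unfolding agree_def schouten_bracket_def by (simp_all add: r_bracket_zero phi_zero bil r_bil)
  have add_left: "agree (s + s') t" if "agree s t" "agree s' t" for s s' t
  proof -
    have "schouten_bracket (r_bracket act (s + s')) (r_bracket act t) a b c =
        schouten_bracket (r_bracket act s) (r_bracket act t) a b c +
        schouten_bracket (r_bracket act s') (r_bracket act t) a b c"
      unfolding schouten_bracket_def r_bracket_add r_bil by (simp add: algebra_simps)
    then show ?thesis using that by (simp add: agree_def bil phi_add)
  qed
  have add_right: "agree s (t + t')" if "agree s t" "agree s t'" for s t t'
  proof -
    have "schouten_bracket (r_bracket act s) (r_bracket act (t + t')) a b c =
        schouten_bracket (r_bracket act s) (r_bracket act t) a b c +
        schouten_bracket (r_bracket act s) (r_bracket act t') a b c"
      unfolding schouten_bracket_def r_bracket_add r_bil by (simp add: algebra_simps)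
    then show ?thesis using that by (simp add: agree_def bil phi_add)
  qed
  have "agree (wedge2 x y) (r_matrix Q G)" for x y
    by (rule r_matrix_induct)
      (auto simp: zero add_right agree_def[of "wedge2 _ _" "wedge2 _ _"] schouten_bracket_wedge2)
  then have "agree (r_matrix P E) (r_matrix Q G)"
    by (rule r_matrix_induct[of "\<lambda>s. agree s (r_matrix Q G)", OF zero(1) _ add_left])
  then show ?thesis by (simp add: agree_def)
qed

end

section \<open>The first order part of the quantum group invariance\<close>

lemma ring_inverse_eqI:
  fixes x y :: "'a::ring_1"
  assumes "x * y = 1" "y * x = 1"
  shows "ring_inverse x = y"
  unfolding ring_inverse_def
proof (rule the_equality)
  fix z assume z: "x * z = 1 \<and> z * x = 1"
  have "z = z * (x * y)" by (simp add: assms)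
  also have "\<dots> = y" using z by (simp flip: mult.assoc)
  finally show "z = y" .
qed (use assms in simp)

lemma mult_ring_inverse_fps:
  fixes F :: "'b::ring_1 fps"
  assumes "F $ 0 = 1"
  shows "F * ring_inverse F = 1"
proof -
  have "F * fps_right_inverse F 1 = 1" "fps_right_inverse F 1 * F = 1"
    using assms by (intro fps_right_inverse fps_left_inverse'[where x=1]; simp)+
  then show ?thesis using ring_inverse_eqI[of F "fps_right_inverse F 1"] by simp
qed

text \<open>
  \<open>F\<^sup>-\<^sup>1 = 1 - h F\<^sub>1 + \<cdots>\<close>, so conjugation by \<open>F\<close> is in first order the commutator with \<open>F\<^sub>1\<close>.
\<close>

lemma comult_h_const_nth:
  assumes "F $ 0 = 1"
  shows "comult_h F (fps_const u) $ 0 = comult u"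
    and "comult_h F (fps_const u) $ 1 = F $ 1 * comult u - comult u * F $ 1"
proof -
  let ?G = "ring_inverse F"
  have "(F * ?G) $ 0 = 1" "(F * ?G) $ 1 = 0"
    unfolding mult_ring_inverse_fps[OF assms] by simp_all
  then have G: "?G $ 0 = 1" "?G $ Suc 0 = - F $ 1"
    using assms by (simp_all add: fps_mult_nth eq_neg_iff_add_eq_0)
  have D: "fps_extend comult (fps_const u) = fps_const (comult u)"
    by (rule fps_ext) (simp add: fps_extend_def)
  show "comult_h F (fps_const u) $ 0 = comult u"
    "comult_h F (fps_const u) $ 1 = F $ 1 * comult u - comult u * F $ 1"
    unfolding comult_h_def D using assms by (simp_all add: fps_mult_nth G)
qed

lemma uh_invariant_first_order:
  assumes act: "uea_module act" and "uh_invariant act F m" and F: "F $ 0 = 1"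
  shows "act u (mult_coeff m 1 a b) = tensor_lift (mult_coeff m 1) (act2 act (comult u) (a \<otimes>\<^sub>t b)) +
    tensor_lift (mult_coeff m 0) (act2 act (F $ 1 * comult u - comult u * F $ 1) (a \<otimes>\<^sub>t b))"
proof -
  note bil = cbilinearD[OF uea_moduleD(1)[OF act]]
  define T where "T = fps_extend2 (act2 act) (comult_h F (fps_const u)) (fps_const (a \<otimes>\<^sub>t b))"
  have "T $ 0 = act2 act (comult u) (a \<otimes>\<^sub>t b)"
    "T $ 1 = act2 act (F $ 1 * comult u - comult u * F $ 1) (a \<otimes>\<^sub>t b)"
    unfolding T_def fps_extend2_def
    by (simp_all add: act2_right[OF act] comult_h_const_nth[OF F]
        comult_h_const_nth(2)[OF F, simplified])
  moreover have "fps_extend2 act (fps_const u) (m (fps_const a) (fps_const b)) $ 1 =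
      act u (mult_coeff m 1 a b)"
    by (simp add: fps_extend2_def mult_coeff_def bil)
  moreover have "fps_extend2 act (fps_const u) (m (fps_const a) (fps_const b)) = mult_tensor m T"
    using assms(2) by (simp add: uh_invariant_def T_def)
  ultimately show ?thesis
    by (simp add: mult_tensor_def add.commute)
qed

lemma tensor_lift_times_act2_r_uea:
  assumes "invariant_algebra act"
  shows "tensor_lift (*) (act2 act (r_uea r) (a \<otimes>\<^sub>t b)) = r_bracket act r a b"
proof (induction r rule: tensor_induct)
  case (pure x y)
  show ?case
    using assms by (simp add: r_uea_def tensor_map_pure clinear_uea_gen act2_pure
        cbilinear_times r_bracket_pure invariant_algebra_def)
qed (simp_all add: r_uea_def tensor_map_def r_bracket_def act2_zero_left act2_add_left
    act2_scaleC_left)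

text \<open>
  Let \<open>Z(a,b) = {xa,b}\<^sub>r + {a,xb}\<^sub>r - x{a,b}\<^sub>r\<close>. First order invariance says that
  \<open>x \<mu>\<^sub>1(a,b) - \<mu>\<^sub>1(xa,b) - \<mu>\<^sub>1(a,xb)\<close> is \<open>(1/2) Z(a,b)\<close>. As \<open>Z\<close> is skew, the two halves in the
  commutator of \<open>\<mu>\<^sub>1\<close> add up to \<open>Z\<close>, which is just what adding \<open>{a,b}\<^sub>r\<close> cancels.
\<close>

lemma semiclassical_plus_r_bracket_invariant:
  assumes inv: "invariant_algebra act" and quant: "quantization m" and uh: "uh_invariant act F m"
    and F: "F $ 0 = 1" "F $ 1 = (1/2) *\<^sub>C r_uea r"
    and skew: "\<And>a b. r_bracket act r a b = - r_bracket act r b a"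
  shows "act (uea_gen x) (semiclassical_bracket m a b) + act (uea_gen x) (r_bracket act r a b) =
    semiclassical_bracket m (act (uea_gen x) a) b + semiclassical_bracket m a (act (uea_gen x) b) +
    (r_bracket act r (act (uea_gen x) a) b + r_bracket act r a (act (uea_gen x) b))"
proof -
  have act: "uea_module act" and inv_times: "invariant_map act (*)"
    using inv by (auto simp: invariant_algebra_def)
  define D where "D = act (uea_gen x)"
  define Z where "Z a b =
    r_bracket act r (D a) b + r_bracket act r a (D b) - D (r_bracket act r a b)" for a b
  have \<Delta>: "act2 act (comult (uea_gen x)) (a \<otimes>\<^sub>t b) = D a \<otimes>\<^sub>t b + a \<otimes>\<^sub>t D b" for a b
    by (simp add: D_def act2_add_left act2_pure act uea_moduleD(3))
  have m0: "mult_coeff m 0 = (*)"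
    by (intro ext) (rule mult_coeff_0[OF quant])
  have order1: "D (mult_coeff m 1 a b) =
      mult_coeff m 1 (D a) b + mult_coeff m 1 a (D b) + (1/2) *\<^sub>C Z a b" for a b
  proof -
    have comm: "F $ 1 * comult (uea_gen x) - comult (uea_gen x) * F $ 1 =
        (1/2) *\<^sub>C (r_uea r * comult (uea_gen x) - comult (uea_gen x) * r_uea r)"
      unfolding F times_tensor_scale_left times_tensor_scale_right cvec.scale_right_diff_distrib ..
    have "tensor_lift (*) (act2 act (r_uea r * comult (uea_gen x)) (a \<otimes>\<^sub>t b)) =
        r_bracket act r (D a) b + r_bracket act r a (D b)"
      unfolding act2_mult[OF act] \<Delta> act2_add_right[OF act]
      by (simp add: tensor_lift_times_act2_r_uea[OF inv])
    moreover have "tensor_lift (*) (act2 act (comult (uea_gen x) * r_uea r) (a \<otimes>\<^sub>t b)) =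
        D (r_bracket act r a b)"
      unfolding act2_mult[OF act] D_def
      by (simp only: invariant_map_tensor[OF act cbilinear_times inv_times, symmetric]
          tensor_lift_times_act2_r_uea[OF inv])
    ultimately have "tensor_lift (*)
        (act2 act (F $ 1 * comult (uea_gen x) - comult (uea_gen x) * F $ 1) (a \<otimes>\<^sub>t b)) = (1/2) *\<^sub>C Z a b"
      unfolding comm act2_scaleC_left act2_diff_left by (simp add: Z_def)
    then show ?thesis
      using uh_invariant_first_order[OF act uh F(1), of "uea_gen x" a b]
      unfolding m0 \<Delta> tensor_lift_add
      by (simp add: D_def cbilinear_mult_coeff[OF quantization_bilinear[OF quant]])
  qed
  have "Z b a = - Z a b"
    unfolding Z_def skew[of "D b" a] skew[of b "D a"] skew[of b a]
    by (simp add: D_def cbilinearD[OF uea_moduleD(1)[OF act]])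
  then have "(1/2) *\<^sub>C Z a b - (1/2) *\<^sub>C Z b a = (1/2) *\<^sub>C Z a b + (1/2) *\<^sub>C Z a b"
    by simp
  also have "\<dots> = Z a b"
    by (simp add: scaleC_one flip: scaleC_add_left)
  finally have Z: "(1/2) *\<^sub>C Z a b - (1/2) *\<^sub>C Z b a = Z a b" .
  have "D (semiclassical_bracket m a b) = D (mult_coeff m 1 a b) - D (mult_coeff m 1 b a)"
    by (simp add: semiclassical_bracket_def D_def cbilinearD[OF uea_moduleD(1)[OF act]])
  also have "\<dots> = semiclassical_bracket m (D a) b + semiclassical_bracket m a (D b) +
      ((1/2) *\<^sub>C Z a b - (1/2) *\<^sub>C Z b a)"
    unfolding order1 semiclassical_bracket_def by simp
  finally have "D (semiclassical_bracket m a b) =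
      semiclassical_bracket m (D a) b + semiclassical_bracket m a (D b) + Z a b"
    unfolding Z .
  then show ?thesis
    by (simp add: Z_def D_def algebra_simps)
qed

section \<open>Decomposition of the Poisson bracket\<close>

theorem proposition2p2:
  fixes H :: "'g::complex_lie_algebra set"
    and P :: "('g \<Rightarrow> complex) set"
    and E :: "('g \<Rightarrow> complex) \<Rightarrow> 'g"
    and \<kappa> :: complex
    and \<Phi> :: "'g uea3 fps"
    and F :: "'g uea2 fps"
    and act :: "'g uea \<Rightarrow> 'a::complex_comm_algebra \<Rightarrow> 'a"
    and m :: "'a fps \<Rightarrow> 'a fps \<Rightarrow> 'a fps"
  assumes "simple_lie_algebra TYPE('g)"
    and "cartan_subalgebra H"
    and "positive_roots H P"
    and "normalized_root_vectors H P E"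
    and "drinfeld_associator (\<kappa> *\<^sub>C phi_uea (phi_tensor P E)) \<Phi>"
    and "drinfeld_twist (r_uea (r_matrix P E)) \<Phi> F"
    and "invariant_algebra act"
    and "quantization m"
    and "uh_invariant act F m"
  shows "\<exists>f. is_bracket f \<and> invariant_map act f \<and>
    (\<forall>a b. semiclassical_bracket m a b = f a b - r_bracket act (r_matrix P E) a b) \<and>
    compatible f (r_bracket act (r_matrix P E)) \<and>
    (\<forall>a b c. schouten_bracket f f a b c = - phi_map act (phi_tensor P E) a b c)"
proof (intro exI conjI allI)
  let ?r = "r_bracket act (r_matrix P E)" and ?p = "semiclassical_bracket m"
  define f where "f = (\<lambda>a b. ?p a b + ?r a b)"
  have F: "F $ 0 = 1" "F $ 1 = (1/2) *\<^sub>C r_uea (r_matrix P E)"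
    using assms(6) by (auto simp: drinfeld_twist_def)
  have act: "uea_module act"
    using assms(7) by (simp add: invariant_algebra_def)
  have r: "is_bracket ?r"
    by (rule is_bracket_r_bracket[OF assms(7)])
  show f: "is_bracket f"
    unfolding f_def by (rule is_bracket_add[OF is_bracket_semiclassical_bracket[OF assms(8)] r])
  note f_bil = is_bracketD(1)[OF f] and r_bil = is_bracketD(1)[OF r]
  show inv_f: "invariant_map act f"
    unfolding invariant_map_iff_generators[OF act f_bil]
    using semiclassical_plus_r_bracket_invariant[OF assms(7,8,9) F is_bracketD(2)[OF r]]
    by (simp add: f_def cbilinearD[OF uea_moduleD(1)[OF act]] add_ac)
  show p: "?p a b = f a b - ?r a b" for a b
    by (simp add: f_def)
  show compat: "compatible f ?r"
    by (rule r_bracket_compatible_invariant[OF assms(7) f inv_f])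
  show "schouten_bracket f f a b c = - phi_map act (phi_tensor P E) a b c" for a b c
  proof -
    have "?p = (\<lambda>a b. f a b - ?r a b)"
      by (intro ext) (rule p)
    then have "schouten_bracket f f a b c + schouten_bracket ?r ?r a b c =
        schouten_bracket ?p ?p a b c"
      by (simp only: schouten_bracket_diff[OF f_bil r_bil compat])
    also have "\<dots> = 0"
      by (rule semiclassical_bracket_jacobi[OF assms(8)])
    finally show ?thesis
      by (simp only: schouten_bracket_r_bracket[OF assms(7)] eq_neg_iff_add_eq_0)
  qed
qed

end
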